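(* Let $T:(x_1,x_2,X,y_1,y_2,Y,z_1,z_2,Z)\mapsto(u_1,u_2,U,v_1,v_2,V,w_1,w_2,W)$ be the nine-dimensional rational map given by $$u_1=\frac{E\,[x_1X(y_1y_2Y-1)+y_1z_2Z]\,Y}{(x_1x_2X-1)X(z_1z_2Z-1)^2Z},\quad u_2=(x_2+y_2z_1Y)\frac{Z}{Y},\quad U=\frac{(x_1x_2X-1)X(z_1z_2Z-1)}{E},$$ $$v_1=\frac{y_1+x_1z_1X(y_1y_2Y-1)}{E\,X},\quad v_2=\frac{(x_1x_2X-1)X(y_2Y+x_2z_2Z)(z_1z_2Z-1)}{E\,Y},\quad V=\frac{E\,Y}{(x_1x_2X-1)(z_1z_2Z-1)},$$ $$w_1=\frac{x_2y_1+z_1(y_1y_2Y-1)}{x_1x_2X-1},\quad w_2=\frac{(x_1y_2XY+z_2Z)\,E}{(x_1x_2X-1)(z_1z_2Z-1)Z},\quad W=\frac{(x_1x_2X-1)(z_1z_2Z-1)Z}{E},$$ where $E=1+x_2y_1z_2Z+(y_1y_2Y-1)[x_1(x_2+y_2z_1Y)X+z_1z_2Z]$. 1. The quantities $\Phi=X-x_1x_2X^2$, $\Psi=Y-y_1y_2Y^2$ and $\Omega=Z-z_1z_2Z^2$ are invariants of $T$. 2. For nonzero $a,b,c\in\mathbb C$, the map $T$ can be restricted, on the invariant leaves $$A_a=\{(x_1,x_2,X)\in\mathbb C^3: X-x_1x_2X^2=a\},\quad B_b=\{(y_1,y_2,Y)\in\mathbb C^3: Y-y_1y_2Y^2=b\},\quad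 C_c=\{(z_1,z_2,Z)\in\mathbb C^3: Z-z_1z_2Z^2=c\},$$ to a six-dimensional parametric tetrahedron map $T_{a,b,c}:(x_1,X,y_1,Y,z_1,Z)\mapsto(u_1,U,v_1,V,w_1,W)$ given by $$u_1=\frac{f_{b,c}(X,Y,Z)\,N}{ac^2x_1y_1z_1^2X^2Y^2Z},\qquad U=\frac{acx_1y_1z_1X^2Y^2}{N},$$ $$v_1=\frac{x_1y_1z_1XYZ\,f_{b,0}(X,Y,-1)}{N},\qquad V=\frac{N}{acx_1y_1z_1XY},$$ $$w_1=\frac{f_{b,a}(X,Y,X)}{ax_1XY},\qquad W=\frac{acx_1y_1z_1XY^2Z}{N},$$ where $f_{b,c}(X,Y,Z)=bx_1z_1XZ+y_1Y(c-Z)$ and $N=f_{b,a}(X,Y,X)f_{b,c}(X,Y,Z)+f_{b,0}(X,Y,-1)x_1z_1X^2YZ$. 3. The map $T_{a,b,c}$ admits the invariants $$I_1=\frac{X}{Z},\qquad I_2=XY,\qquad I_3=Z-bX-aYZ+\frac{y_1Y(a-X)(c-Z)}{x_1z_1XZ}-\frac{x_1z_1XZ(b-Y)}{y_1Y}.$$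
   Context: All maps are rational maps and identities between them are understood as identities of rational functions. The notation $f_{\beta,\gamma}(X,Y,\zeta)$ means $\beta x_1z_1X\zeta+y_1Y(\gamma-\zeta)$ with the same $x_1,y_1,z_1$; thus $f_{b,a}(X,Y,X)=bx_1z_1X^2+y_1Y(a-X)$ and $f_{b,0}(X,Y,-1)=y_1Y-bx_1z_1X$. A function $I$ is an invariant of a map if its value at the image point (i.e. with $x_i,y_i,z_i,X,Y,Z$ replaced by $u_i,v_i,w_i,U,V,W$) equals its value at the original point. Parametric tetrahedron map: a family of rational maps $T_{a,b,c}:\mathcal X^3\to\mathcal X^3$ is a parametric tetrahedron map if $$T^{123}_{a,b,c}\circ T^{145}_{a,d,e}\circ T^{246}_{b,d,f}\circ T^{356}_{c,e,f}=T^{356}_{c,e,f}\circ T^{246}_{b,d,f}\circ T^{145}_{a,d,e}\circ T^{123}_{a,b,c}$$ on $\mathcal X^6$ for all parameters $a,b,c,d,e,f$, where $T^{ijk}$ acts as $T$ on the $i$-th, $j$-th, $k$-th factors (in this order) of $\mathcal X^6$ and as the identity on the others. Here $\mathcal X=\mathbb C^2$, the three factors having coordinates $(x_1,X)$, $(y_1,Y)$, $(z_1,Z)$ and the image $(u_1,U)$, $(v_1,V)$, $(w_1,W)$. Restriction to the leaves means: $T$ maps $A_a\times B_b\times C_c$ to itself, and $T_{a,b,c}$ is the induced map in the (generic) coordinates $(x_1,X,y_1,Y,z_1,Z)$ on the leaves. *)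

theory Defs
  imports "HOL-Analysis.Analysis"
begin

text \<open>
  Affine complex spaces are built from \<^typ>\<open>complex\<close> by binary products and by finite powers;
  \<open>coords\<close> is the set of their coordinate functions.
\<close>

class affine_space =
  fixes coords :: "('a \<Rightarrow> complex) set"

instantiation complex :: affine_space
begin
definition coords_complex :: "(complex \<Rightarrow> complex) set" where
  "coords_complex = {id}"
instance ..
end

instantiation prod :: (affine_space, affine_space) affine_space
begin
definition coords_prod :: "('a \<times> 'b \<Rightarrow> complex) set" where
  "coords_prod = {f \<circ> fst | f. f \<in> coords} \<union> {g \<circ> snd | g. g \<in> coords}"
instance ..
end

instantiation vec :: (affine_space, finite) affine_space
begin
definition coords_vec :: "('a ^ 'b \<Rightarrow> complex) set" where
  "coords_vec = {\<lambda>v. f (v $ i) | f i. f \<in> coords}"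
instance ..
end

inductive_set polynomials :: "('a::affine_space \<Rightarrow> complex) set" where
  const: "(\<lambda>_. c) \<in> polynomials"
| coord: "f \<in> coords \<Longrightarrow> f \<in> polynomials"
| add: "p \<in> polynomials \<Longrightarrow> q \<in> polynomials \<Longrightarrow> (\<lambda>v. p v + q v) \<in> polynomials"
| mult: "p \<in> polynomials \<Longrightarrow> q \<in> polynomials \<Longrightarrow> (\<lambda>v. p v * q v) \<in> polynomials"

text \<open>
  \<open>generically P\<close>: the property holds on a nonempty Zariski-open subset. As the complements of
  the hypersurfaces \<open>p = 0\<close> are a basis of the Zariski topology, it is enough to consider these.
\<close>

definition generically :: "('a::affine_space \<Rightarrow> bool) \<Rightarrow> bool" where
  "generically P \<longleftrightarrow> (\<exists>p \<in> polynomials. (\<exists>v. p v \<noteq> 0) \<and> (\<forall>v. p v \<noteq> 0 \<longrightarrow> P v))"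

text \<open>
  A rational map is represented by a partial function, undefined where a denominator vanishes,
  and rational maps compose as partial functions, by \<open>\<circ>\<^sub>m\<close>. Two partial functions represent
  the same rational map if both are defined and equal on a nonempty Zariski-open set. In particular
  \<open>rat_eq\<close> between composites contains the claim that the composites exist as rational maps.
\<close>

definition rational_map :: "('a::affine_space \<rightharpoonup> 'b::affine_space) \<Rightarrow> bool" where
  "rational_map f \<longleftrightarrow> (\<forall>\<phi> \<in> coords. \<exists>n \<in> polynomials. \<exists>d \<in> polynomials.
     (\<exists>v. d v \<noteq> 0) \<and> (\<forall>v. d v \<noteq> 0 \<longrightarrow> (\<exists>w. f v = Some w \<and> \<phi> w = n v / d v)))"

definition rat_eq :: "('a::affine_space \<rightharpoonup> 'b) \<Rightarrow> ('a \<rightharpoonup> 'b) \<Rightarrow> bool" where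
  "rat_eq f g \<longleftrightarrow> generically (\<lambda>v. \<exists>w. f v = Some w \<and> g v = Some w)"

definition is_invariant :: "('a::affine_space \<rightharpoonup> 'a) \<Rightarrow> ('a \<rightharpoonup> complex) \<Rightarrow> bool" where
  "is_invariant T I \<longleftrightarrow> rat_eq (I \<circ>\<^sub>m T) I"

definition act_on :: "'n \<Rightarrow> 'n \<Rightarrow> 'n \<Rightarrow> ('a \<times> 'a \<times> 'a \<rightharpoonup> 'a \<times> 'a \<times> 'a) \<Rightarrow> ('a ^ 'n \<rightharpoonup> 'a ^ 'n)" where
  "act_on i j k T v = map_option
     (\<lambda>(p, q, r). \<chi> l. if l = i then p else if l = j then q else if l = k then r else v $ l)
     (T (v $ i, v $ j, v $ k))"

text \<open>
  The six factors are indexed by the type \<open>6\<close>, in which the index \<open>6\<close> coincides with \<open>0\<close>; the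
  indices \<open>1, \<dots>, 6\<close> are distinct and exhaust the type. \<open>P\<close> is the set of admissible parameters.
\<close>

definition parametric_tetrahedron_map ::
  "'p set \<Rightarrow> ('p \<Rightarrow> 'p \<Rightarrow> 'p \<Rightarrow> ('a::affine_space) \<times> 'a \<times> 'a \<rightharpoonup> 'a \<times> 'a \<times> 'a) \<Rightarrow> bool" where
  "parametric_tetrahedron_map P T \<longleftrightarrow>
     (\<forall>a \<in> P. \<forall>b \<in> P. \<forall>c \<in> P. rational_map (T a b c)) \<and>
     (\<forall>a \<in> P. \<forall>b \<in> P. \<forall>c \<in> P. \<forall>d \<in> P. \<forall>e \<in> P. \<forall>f \<in> P.
        rat_eq
          (act_on (1::6) 2 3 (T a b c) \<circ>\<^sub>m act_on 1 4 5 (T a d e) \<circ>\<^sub>m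
             act_on 2 4 6 (T b d f) \<circ>\<^sub>m act_on 3 5 6 (T c e f))
          (act_on 3 5 6 (T c e f) \<circ>\<^sub>m act_on 2 4 6 (T b d f) \<circ>\<^sub>m
             act_on 1 4 5 (T a d e) \<circ>\<^sub>m act_on 1 2 3 (T a b c)))"

type_synonym complex3 = "complex \<times> complex \<times> complex"

definition T9 :: "complex3 \<times> complex3 \<times> complex3 \<rightharpoonup> complex3 \<times> complex3 \<times> complex3" where
  "T9 = (\<lambda>((x1, x2, X), (y1, y2, Y), (z1, z2, Z)).
     let E = 1 + x2*y1*z2*Z + (y1*y2*Y - 1) * (x1*(x2 + y2*z1*Y)*X + z1*z2*Z) in
     if X = 0 \<or> Y = 0 \<or> Z = 0 \<or> x1*x2*X - 1 = 0 \<or> z1*z2*Z - 1 = 0 \<or> E = 0 then None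
     else Some
      ((E * (x1*X*(y1*y2*Y - 1) + y1*z2*Z) * Y / ((x1*x2*X - 1) * X * (z1*z2*Z - 1)^2 * Z),
        (x2 + y2*z1*Y) * (Z / Y),
        (x1*x2*X - 1) * X * (z1*z2*Z - 1) / E),
       ((y1 + x1*z1*X*(y1*y2*Y - 1)) / (E*X),
        (x1*x2*X - 1) * X * (y2*Y + x2*z2*Z) * (z1*z2*Z - 1) / (E*Y),
        E*Y / ((x1*x2*X - 1) * (z1*z2*Z - 1))),
       ((x2*y1 + z1*(y1*y2*Y - 1)) / (x1*x2*X - 1),
        (x1*y2*X*Y + z2*Z) * E / ((x1*x2*X - 1) * (z1*z2*Z - 1) * Z),
        (x1*x2*X - 1) * (z1*z2*Z - 1) * Z / E)))"

definition f_poly ::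
  "complex \<Rightarrow> complex \<Rightarrow> complex \<Rightarrow> complex \<Rightarrow> complex \<Rightarrow> complex \<Rightarrow> complex \<Rightarrow> complex \<Rightarrow> complex" where
  "f_poly x1 y1 z1 \<beta> \<gamma> X Y \<zeta> = \<beta>*x1*z1*X*\<zeta> + y1*Y*(\<gamma> - \<zeta>)"

type_synonym complex2 = "complex \<times> complex"

definition T6 :: "complex \<Rightarrow> complex \<Rightarrow> complex \<Rightarrow>
    complex2 \<times> complex2 \<times> complex2 \<rightharpoonup> complex2 \<times> complex2 \<times> complex2" where
  "T6 a b c = (\<lambda>((x1, X), (y1, Y), (z1, Z)).
     let f = f_poly x1 y1 z1;
         N = f b a X Y X * f b c X Y Z + f b 0 X Y (-1) * x1*z1*X^2*Y*Z in
     if a = 0 \<or> c = 0 \<or> x1 = 0 \<or> y1 = 0 \<or> z1 = 0 \<or> X = 0 \<or> Y = 0 \<or> Z = 0 \<or> N = 0 then None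
     else Some
      ((f b c X Y Z * N / (a*c^2*x1*y1*z1^2*X^2*Y^2*Z),
        a*c*x1*y1*z1*X^2*Y^2 / N),
       (x1*y1*z1*X*Y*Z * f b 0 X Y (-1) / N,
        N / (a*c*x1*y1*z1*X*Y)),
       (f b a X Y X / (a*x1*X*Y),
        a*c*x1*y1*z1*X*Y^2*Z / N)))"

definition leaf :: "complex \<Rightarrow> complex3 set" where
  "leaf a = {(x1, x2, X). X - x1*x2*X^2 = a}"

definition leaf_coords :: "complex3 \<times> complex3 \<times> complex3 \<Rightarrow> complex2 \<times> complex2 \<times> complex2" where
  "leaf_coords = (\<lambda>((x1, x2, X), (y1, y2, Y), (z1, z2, Z)). ((x1, X), (y1, Y), (z1, Z)))"

text \<open>
  \<open>T\<close> maps \<open>L\<close> to itself (wherever \<open>T\<close> is defined), \<open>\<pi>\<close> provides generic coordinates on \<open>L\<close>, and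
  in these coordinates the rational map induced by \<open>T\<close> is \<open>S\<close>.
\<close>

definition restricts_to ::
  "('a \<rightharpoonup> 'a) \<Rightarrow> 'a set \<Rightarrow> ('a \<Rightarrow> 'b::affine_space) \<Rightarrow> ('b \<rightharpoonup> 'b) \<Rightarrow> bool" where
  "restricts_to T L \<pi> S \<longleftrightarrow>
     (\<forall>p \<in> L. \<forall>p'. T p = Some p' \<longrightarrow> p' \<in> L) \<and>
     generically (\<lambda>r. (\<exists>!p. p \<in> L \<and> \<pi> p = r) \<and>
       (\<forall>p \<in> L. \<pi> p = r \<longrightarrow> (\<exists>p'. T p = Some p' \<and> S r = Some (\<pi> p'))))"

definition I1 :: "complex2 \<times> complex2 \<times> complex2 \<rightharpoonup> complex" where
  "I1 = (\<lambda>((x1, X), (y1, Y), (z1, Z)). if Z = 0 then None else Some (X / Z))"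

definition I2 :: "complex2 \<times> complex2 \<times> complex2 \<rightharpoonup> complex" where
  "I2 = (\<lambda>((x1, X), (y1, Y), (z1, Z)). Some (X * Y))"

definition I3 :: "complex \<Rightarrow> complex \<Rightarrow> complex \<Rightarrow> complex2 \<times> complex2 \<times> complex2 \<rightharpoonup> complex" where
  "I3 a b c = (\<lambda>((x1, X), (y1, Y), (z1, Z)).
     if x1 = 0 \<or> z1 = 0 \<or> X = 0 \<or> Z = 0 \<or> y1 = 0 \<or> Y = 0 then None
     else Some (Z - b*X - a*Y*Z + y1*Y*(a - X)*(c - Z) / (x1*z1*X*Z) - x1*z1*X*Z*(b - Y) / (y1*Y)))"

end

theory Submission
  imports Defs
begin

text \<open>
  Put \<open>L\<^sub>i\<^sub>j(x, X)\<close> for the operator acting on coordinates \<open>i, j\<close> by the matrix with rows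
  \<open>(X, xX)\<close> and \<open>((X - a) / (xX), 1)\<close>, of determinant \<open>a\<close>. The map \<open>T\<close> with parameters
  \<open>a, b, c\<close> solves the refactorisation problem
  \<open>L\<^sub>1\<^sub>2(u) L\<^sub>1\<^sub>3(v) L\<^sub>2\<^sub>3(w) = L\<^sub>2\<^sub>3(z) L\<^sub>1\<^sub>3(y) L\<^sub>1\<^sub>2(x)\<close>. Both sides of the tetrahedron
  equation therefore transform the word \<open>L\<^sub>3\<^sub>4 L\<^sub>2\<^sub>4 L\<^sub>1\<^sub>4 L\<^sub>2\<^sub>3 L\<^sub>1\<^sub>3 L\<^sub>1\<^sub>2\<close> into its reversal with the
  same product, and a product in the reversed order determines its six factors: the bottom row
  and the preimage of the last basis vector give those involving index 4, and one cancels these.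
  It remains to see that the composites are generically defined. Domains of composites are
  complements of hypersurfaces, so one point suffices; where all Lax matrices are upper
  triangular, that is \<open>X = a\<close>, the map is simple enough to exhibit such a point.
\<close>

section \<open>Regular maps\<close>

lemma polynomials_minus:
  assumes "p \<in> polynomials" "q \<in> polynomials"
  shows "(\<lambda>v. p v - q v) \<in> polynomials"
  using polynomials.add[OF assms(1) polynomials.mult[OF polynomials.const[of "-1"] assms(2)]]
  by simp

lemma polynomials_power:
  assumes "p \<in> polynomials"
  shows "(\<lambda>v. p v ^ k) \<in> polynomials"
  by (induction k) (auto intro: polynomials.intros assms)

lemma polynomials_prod:
  assumes "\<And>i. i \<in> I \<Longrightarrow> p i \<in> polynomials"
  shows "(\<lambda>v. \<Prod>i\<in>I. p i v) \<in> polynomials"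
  using assms by (induction I rule: infinite_finite_induct) (auto intro: polynomials.intros)

lemmas polynomials_intros =
  polynomials.const polynomials.add polynomials.mult
  polynomials_minus polynomials_power polynomials_prod

text \<open>For a polynomial \<open>d\<close> this is the localisation of the polynomial ring at
  \<open>d\<close>, read as functions on the complement of \<open>d = 0\<close>. Values on the
  hypersurface itself are left arbitrary.\<close>

definition regular_on :: "('a::affine_space \<Rightarrow> complex) \<Rightarrow> ('a \<Rightarrow> complex) set" where
  "regular_on d = {g. \<exists>n\<in>polynomials. \<exists>k. \<forall>v. d v \<noteq> 0 \<longrightarrow> g v = n v / d v ^ k}"

lemma regular_onI:
  assumes "n \<in> polynomials" "\<And>v. d v \<noteq> 0 \<Longrightarrow> g v = n v / d v ^ k"
  shows "g \<in> regular_on d"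
  using assms unfolding regular_on_def by blast

lemma regular_onE:
  assumes "g \<in> regular_on d"
  obtains n k where "n \<in> polynomials" "\<And>v. d v \<noteq> 0 \<Longrightarrow> g v = n v / d v ^ k"
  using assms unfolding regular_on_def by blast

lemma regular_on_cong:
  assumes "g \<in> regular_on d" "\<And>v. d v \<noteq> 0 \<Longrightarrow> h v = g v"
  shows "h \<in> regular_on d"
  using assms unfolding regular_on_def by auto

lemma regular_on_polynomial:
  assumes "p \<in> polynomials"
  shows "p \<in> regular_on d"
  by (rule regular_onI[OF assms, of _ _ 0]) simp

lemma regular_on_add:
  assumes d: "d \<in> polynomials" and "g \<in> regular_on d" "h \<in> regular_on d"
  shows "(\<lambda>v. g v + h v) \<in> regular_on d"
proof -
  obtain n k m l where *: "n \<in> polynomials" "m \<in> polynomials"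
    "\<And>v. d v \<noteq> 0 \<Longrightarrow> g v = n v / d v ^ k" "\<And>v. d v \<noteq> 0 \<Longrightarrow> h v = m v / d v ^ l"
    using assms unfolding regular_on_def by blast
  have "(\<lambda>v. n v * d v ^ l + m v * d v ^ k) \<in> polynomials"
    by (intro polynomials_intros * d)
  moreover have "g v + h v = (n v * d v ^ l + m v * d v ^ k) / d v ^ (k + l)" if "d v \<noteq> 0" for v
    using that * by (simp add: field_simps power_add)
  ultimately show ?thesis
    by (intro regular_onI)
qed

lemma regular_on_mult:
  assumes "g \<in> regular_on d" "h \<in> regular_on d"
  shows "(\<lambda>v. g v * h v) \<in> regular_on d"
proof -
  obtain n k m l where *: "n \<in> polynomials" "m \<in> polynomials"
    "\<And>v. d v \<noteq> 0 \<Longrightarrow> g v = n v / d v ^ k" "\<And>v. d v \<noteq> 0 \<Longrightarrow> h v = m v / d v ^ l"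
    using assms unfolding regular_on_def by blast
  have "(\<lambda>v. n v * m v) \<in> polynomials"
    by (intro polynomials_intros *)
  moreover have "g v * h v = (n v * m v) / d v ^ (k + l)" if "d v \<noteq> 0" for v
    using that * by (simp add: power_add)
  ultimately show ?thesis
    by (intro regular_onI)
qed

text \<open>A denominator \<open>e\<close> that divides a power of \<open>d\<close>, with polynomial
  cofactor \<open>h\<close>, is a unit in the localisation:
  \<open>n / e = n * h / d ^ k\<close>.\<close>

lemma regular_on_divide:
  assumes "n \<in> polynomials" "h \<in> polynomials" "\<And>v. e v * h v = d v ^ k"
  shows "(\<lambda>v. n v / e v) \<in> regular_on d"
proof -
  have "n v / e v = n v * h v / d v ^ k" if "d v \<noteq> 0" for v
  proof -
    have "e v \<noteq> 0" "h v \<noteq> 0"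
      using that assms(3)[of v] by (metis mult_zero_left mult_zero_right power_not_zero)+
    then show ?thesis
      by (simp flip: assms(3))
  qed
  moreover have "(\<lambda>v. n v * h v) \<in> polynomials"
    by (intro polynomials_intros assms)
  ultimately show ?thesis
    by (intro regular_onI)
qed

text \<open>Regular functions form a ring, so a polynomial pulls back to a regular function as soon
  as the coordinate functions do.\<close>

lemma regular_on_compose:
  fixes h :: "'a::affine_space \<Rightarrow> 'b::affine_space"
  assumes d: "d \<in> polynomials" and h: "\<And>\<phi>. \<phi> \<in> coords \<Longrightarrow> (\<lambda>v. \<phi> (h v)) \<in> regular_on d"
    and p: "p \<in> polynomials"
  shows "(\<lambda>v. p (h v)) \<in> regular_on d"
  using p
  by induction (auto intro: h regular_on_add regular_on_mult d
      regular_on_polynomial polynomials.const)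

lemma polynomials_compose:
  fixes h :: "'a::affine_space \<Rightarrow> 'b::affine_space"
  assumes h: "\<And>\<phi>. \<phi> \<in> coords \<Longrightarrow> (\<lambda>v. \<phi> (h v)) \<in> polynomials" and p: "p \<in> polynomials"
  shows "(\<lambda>v. p (h v)) \<in> polynomials"
  using p by induction (auto intro: h polynomials.intros)

text \<open>
  The domain is required to be exactly the complement of one hypersurface. This makes the class
  closed under \<open>\<circ>\<^sub>m\<close> and reduces generic definedness to definedness at a single point.
\<close>

definition regular_map :: "('a::affine_space \<rightharpoonup> 'b::affine_space) \<Rightarrow> bool" where
  "regular_map f \<longleftrightarrow> (\<exists>d \<in> polynomials. (\<forall>v. f v = None \<longleftrightarrow> d v = 0) \<and>
     (\<forall>\<phi>\<in>coords. (\<lambda>v. \<phi> (the (f v))) \<in> regular_on d))"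

lemma regular_mapI:
  assumes "d \<in> polynomials" "\<And>v. f v = None \<longleftrightarrow> d v = 0"
    "\<And>\<phi>. \<phi> \<in> coords \<Longrightarrow> (\<lambda>v. \<phi> (the (f v))) \<in> regular_on d"
  shows "regular_map f"
  using assms unfolding regular_map_def by blast

text \<open>Off \<open>e = 0\<close>, the equation \<open>d\<close> of the domain of
  \<open>f\<close> pulls back along \<open>g\<close> to \<open>n / e ^ k\<close>. Hence the
  composite is undefined exactly where \<open>e * n\<close> vanishes: \<open>e\<close> accounts for
  \<open>g\<close>, and \<open>n\<close> for \<open>f\<close> at the image.\<close>

lemma regular_map_comp:
  assumes "regular_map f" "regular_map g"
  shows "regular_map (f \<circ>\<^sub>m g)"
proof -
  obtain d where d: "d \<in> polynomials" "\<And>v. f v = None \<longleftrightarrow> d v = 0"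
    "\<And>\<phi>. \<phi> \<in> coords \<Longrightarrow> (\<lambda>v. \<phi> (the (f v))) \<in> regular_on d"
    using assms(1) unfolding regular_map_def by blast
  obtain e where e: "e \<in> polynomials" "\<And>v. g v = None \<longleftrightarrow> e v = 0"
    "\<And>\<phi>. \<phi> \<in> coords \<Longrightarrow> (\<lambda>v. \<phi> (the (g v))) \<in> regular_on e"
    using assms(2) unfolding regular_map_def by blast
  obtain n k where n: "n \<in> polynomials" "\<And>v. e v \<noteq> 0 \<Longrightarrow> d (the (g v)) = n v / e v ^ k"
    using regular_onE[OF regular_on_compose[where h = "\<lambda>v. the (g v)", OF e(1) e(3) d(1)]] by blast
  have none: "(f \<circ>\<^sub>m g) v = None \<longleftrightarrow> e v * n v = 0" for v
  proof (cases "g v")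
    case None
    then show ?thesis by (simp add: e(2))
  next
    case (Some w)
    then have "e v \<noteq> 0" using e(2)[of v] by auto
    then show ?thesis using Some d(2)[of w] n(2)[of v] by simp
  qed
  show ?thesis
  proof (rule regular_mapI[OF _ none])
    show "(\<lambda>v. e v * n v) \<in> polynomials"
      by (intro polynomials_intros e n)
  next
    fix \<phi> :: "'b \<Rightarrow> complex" assume "\<phi> \<in> coords"
    then obtain m j where m: "m \<in> polynomials" "\<And>w. d w \<noteq> 0 \<Longrightarrow> \<phi> (the (f w)) = m w / d w ^ j"
      using regular_onE[OF d(3)] by blast
    obtain m' i where m': "m' \<in> polynomials" "\<And>v. e v \<noteq> 0 \<Longrightarrow> m (the (g v)) = m' v / e v ^ i"
      using regular_onE[OF regular_on_compose[where h = "\<lambda>v. the (g v)", OF e(1) e(3) m(1)]] by blast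
    \<comment> \<open>The pullback of a component \<open>m / d ^ j\<close> of \<open>f\<close>. Its
      denominator divides \<open>(e * n) ^ (i + j)\<close>.\<close>
    have "(\<lambda>v. m' v * e v ^ (k * j) / (e v ^ i * n v ^ j)) \<in> regular_on (\<lambda>v. e v * n v)"
      by (rule regular_on_divide[where h = "\<lambda>v. e v ^ j * n v ^ i" and k = "i + j"])
        (auto intro!: polynomials_intros m' e n simp: power_add power_mult_distrib)
    then show "(\<lambda>v. \<phi> (the ((f \<circ>\<^sub>m g) v))) \<in> regular_on (\<lambda>v. e v * n v)"
    proof (rule regular_on_cong)
      fix v assume *: "e v * n v \<noteq> 0"
      then obtain w where w: "g v = Some w" using e(2)[of v] by auto
      then have "d w = n v / e v ^ k" "m w = m' v / e v ^ i"
        using n(2)[of v] m'(2)[of v] * by auto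
      then show "\<phi> (the ((f \<circ>\<^sub>m g) v)) = m' v * e v ^ (k * j) / (e v ^ i * n v ^ j)"
        using * w m(2)[of w] by (simp add: power_divide power_mult)
    qed
  qed
qed

section \<open>Rational maps and generic statements from one point of definedness\<close>

lemma rational_mapI:
  assumes "regular_map f" "f v \<noteq> None"
  shows "rational_map f"
  unfolding rational_map_def
proof
  fix \<phi> :: "'b \<Rightarrow> complex" assume "\<phi> \<in> coords"
  then obtain d n k where d: "d \<in> polynomials" "\<And>v. f v = None \<longleftrightarrow> d v = 0"
    and n: "n \<in> polynomials" "\<And>v. d v \<noteq> 0 \<Longrightarrow> \<phi> (the (f v)) = n v / d v ^ k"
    using assms(1) unfolding regular_map_def regular_on_def by blast
  show "\<exists>n\<in>polynomials. \<exists>d\<in>polynomials. (\<exists>v. d v \<noteq> 0) \<and>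
    (\<forall>v. d v \<noteq> 0 \<longrightarrow> (\<exists>w. f v = Some w \<and> \<phi> w = n v / d v))"
  \<comment> \<open>The extra factor \<open>d\<close> matters when \<open>k = 0\<close>: the
    denominator has to vanish wherever \<open>f\<close> is undefined, which \<open>d ^ 0 = 1\<close>
    would not do.\<close>
  proof (rule bexI[of _ "\<lambda>v. n v * d v"], rule bexI[of _ "\<lambda>v. d v ^ Suc k"], intro conjI allI impI)
    show "(\<lambda>v. n v * d v) \<in> polynomials" "(\<lambda>v. d v ^ Suc k) \<in> polynomials"
      by (intro polynomials_intros d n)+
    show "\<exists>v. d v ^ Suc k \<noteq> 0"
      using assms(2) d(2) by (intro exI[of _ v]) simp
    show "\<exists>w. f u = Some w \<and> \<phi> w = n u * d u / d u ^ Suc k" if "d u ^ Suc k \<noteq> 0" for u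
      using that d(2)[of u] n(2)[of u] by auto
  qed
qed

lemma genericallyI:
  assumes "regular_map h" "h v \<noteq> None" "\<And>v. h v \<noteq> None \<Longrightarrow> P v"
  shows "generically P"
  using assms unfolding generically_def regular_map_def by metis

text \<open>The domains of \<open>h\<close> and \<open>k\<close> cut out the open set on which
  \<open>f\<close> and \<open>g\<close> are compared. They share the point \<open>v\<close>, so the
  product of their equations is not the zero function.\<close>

lemma rat_eqI:
  assumes "regular_map h" "regular_map k" "h v \<noteq> None" "k v \<noteq> None"
    and "\<And>v. h v \<noteq> None \<Longrightarrow> k v \<noteq> None \<Longrightarrow> \<exists>w. f v = Some w \<and> g v = Some w"
  shows "rat_eq f g"
proof -
  obtain d e where d: "d \<in> polynomials" "\<And>v. h v = None \<longleftrightarrow> d v = 0"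
    and e: "e \<in> polynomials" "\<And>v. k v = None \<longleftrightarrow> e v = 0"
    using assms(1,2) unfolding regular_map_def by blast
  have "(\<lambda>v. d v * e v) \<in> polynomials"
    by (intro polynomials_intros d e)
  moreover have "d v * e v \<noteq> 0"
    using assms(3,4) d(2) e(2) by simp
  moreover have "\<exists>w. f u = Some w \<and> g u = Some w" if "d u * e u \<noteq> 0" for u
    using that assms(5)[of u] d(2) e(2) by simp
  ultimately show ?thesis
    unfolding rat_eq_def generically_def by (intro bexI[of _ "\<lambda>v. d v * e v"]) auto
qed

lemma invariantI:
  assumes "regular_map T" "regular_map I" "(I \<circ>\<^sub>m T) v \<noteq> None" "I v \<noteq> None"
    and "\<And>v w x y. T v = Some w \<Longrightarrow> I v = Some x \<Longrightarrow> I w = Some y \<Longrightarrow> y = x"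
  shows "is_invariant T I"
  unfolding is_invariant_def
proof (rule rat_eqI[OF regular_map_comp[OF assms(2,1)] assms(2-4)])
  fix u assume "(I \<circ>\<^sub>m T) u \<noteq> None" "I u \<noteq> None"
  then show "\<exists>w. (I \<circ>\<^sub>m T) u = Some w \<and> I u = Some w"
    using assms(5)[of u] by (fastforce simp: map_comp_def split: option.splits)
qed

section \<open>Coordinates of products and powers, and maps acting on three factors\<close>

lemma coords_fst: "g \<in> coords \<Longrightarrow> (\<lambda>v. g (fst v)) \<in> coords"
  and coords_snd: "g \<in> coords \<Longrightarrow> (\<lambda>v. g (snd v)) \<in> coords"
  by (auto simp: coords_prod_def o_def)

lemma coords_vec_nth: "g \<in> coords \<Longrightarrow> (\<lambda>v. g (v $ i)) \<in> coords"
  by (auto simp: coords_vec_def)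

lemma coords_prodE:
  fixes \<phi> :: "'a::affine_space \<times> 'b::affine_space \<Rightarrow> complex"
  assumes "\<phi> \<in> coords"
  obtains g where "g \<in> coords" "\<phi> = (\<lambda>v. g (fst v))" | g where "g \<in> coords" "\<phi> = (\<lambda>v. g (snd v))"
  using assms by (auto simp: coords_prod_def o_def)

text \<open>Selecting three factors is the polynomial map \<open>r\<close>, so the domain is cut out
  by the pullback of \<open>d\<close> along \<open>r\<close>. Each coordinate of the image is a
  component of \<open>T\<close> at \<open>r v\<close> or a coordinate of \<open>v\<close>.\<close>

lemma regular_map_act_on:
  fixes T :: "('a::affine_space) \<times> 'a \<times> 'a \<rightharpoonup> 'a \<times> 'a \<times> 'a" and i j k :: "'n::finite"
  assumes "regular_map T"
  shows "regular_map (act_on i j k T)"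
proof -
  obtain d where d: "d \<in> polynomials" "\<And>v. T v = None \<longleftrightarrow> d v = 0"
    "\<And>\<phi>. \<phi> \<in> coords \<Longrightarrow> (\<lambda>v. \<phi> (the (T v))) \<in> regular_on d"
    using assms(1) unfolding regular_map_def by blast
  define r :: "'a ^ 'n \<Rightarrow> 'a \<times> 'a \<times> 'a" where "r v = (v $ i, v $ j, v $ k)" for v
  have r: "(\<lambda>v. p (r v)) \<in> polynomials" if "p \<in> polynomials" for p
    by (rule polynomials_compose[OF _ that])
      (auto simp: r_def elim!: coords_prodE intro!: polynomials.coord coords_vec_nth)
  have reg: "(\<lambda>v. \<phi> (the (T (r v)))) \<in> regular_on (\<lambda>v. d (r v))" if \<phi>: "\<phi> \<in> coords" for \<phi>
  proof -
    obtain n k where "n \<in> polynomials" "\<And>v. d v \<noteq> 0 \<Longrightarrow> \<phi> (the (T v)) = n v / d v ^ k"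
      using regular_onE[OF d(3)[OF \<phi>]] by blast
    with r[of n] show ?thesis
      by (intro regular_onI[of "\<lambda>v. n (r v)"])
  qed
  show ?thesis
  proof (rule regular_mapI)
    show "(\<lambda>v. d (r v)) \<in> polynomials"
      by (rule r[OF d(1)])
    show "act_on i j k T v = None \<longleftrightarrow> d (r v) = 0" for v
      by (simp add: act_on_def r_def d(2))
  next
    fix \<phi> :: "'a ^ 'n \<Rightarrow> complex" assume "\<phi> \<in> coords"
    then obtain g l where g: "g \<in> coords" and \<phi>: "\<phi> = (\<lambda>v. g (v $ l))"
      by (auto simp: coords_vec_def)
    have "(\<lambda>v. if l = i then g (fst (the (T (r v)))) else if l = j then g (fst (snd (the (T (r v)))))
        else if l = k then g (snd (snd (the (T (r v))))) else g (v $ l)) \<in> regular_on (\<lambda>v. d (r v))"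
      using reg[OF coords_fst[OF g]] reg[OF coords_snd[OF coords_fst[OF g]]]
        reg[OF coords_snd[OF coords_snd[OF g]]]

        regular_on_polynomial[OF polynomials.coord[OF coords_vec_nth[OF g]], of l "\<lambda>v. d (r v)"]
      by (cases "l = i"; cases "l = j"; cases "l = k"; simp)
    then show "(\<lambda>v. \<phi> (the (act_on i j k T v))) \<in> regular_on (\<lambda>v. d (r v))"
    proof (rule regular_on_cong)
      fix v assume "d (r v) \<noteq> 0"
      then obtain w where "T (r v) = Some w" using d(2)[of "r v"] by (cases "T (r v)") auto
      then show "\<phi> (the (act_on i j k T v)) =
        (if l = i then g (fst (the (T (r v)))) else if l = j then g (fst (snd (the (T (r v)))))
        else if l = k then g (snd (snd (the (T (r v))))) else g (v $ l))"
        by (cases w) (auto simp: act_on_def r_def \<phi>)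
    qed
  qed
qed

lemma regular_map_Some:
  assumes "d \<in> polynomials" "\<And>v. f v = (if d v = 0 then None else Some (g v))"
    "\<And>\<phi>. \<phi> \<in> coords \<Longrightarrow> (\<lambda>v. \<phi> (g v)) \<in> regular_on d"
  shows "regular_map f"
proof (rule regular_mapI[OF assms(1)])
  show "f v = None \<longleftrightarrow> d v = 0" for v by (simp add: assms(2))
next
  fix \<phi> :: "'b \<Rightarrow> complex" assume "\<phi> \<in> coords"
  from assms(3)[OF this] show "(\<lambda>v. \<phi> (the (f v))) \<in> regular_on d"
    by (rule regular_on_cong) (simp add: assms(2))
qed

lemma coords_complex: "\<phi> \<in> (coords :: (complex \<Rightarrow> complex) set) \<longleftrightarrow> \<phi> = (\<lambda>v. v)"
  by (simp add: coords_complex_def id_def)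

lemma polynomials_fst: "p \<in> polynomials \<Longrightarrow> (\<lambda>v. p (fst v)) \<in> polynomials"
  by (rule polynomials_compose[of fst]) (auto intro: polynomials.coord coords_fst)

lemma polynomials_snd: "p \<in> polynomials \<Longrightarrow> (\<lambda>v. p (snd v)) \<in> polynomials"
  by (rule polynomials_compose[of snd]) (auto intro: polynomials.coord coords_snd)

lemma polynomials_ident: "(\<lambda>v :: complex. v) \<in> polynomials"
  by (rule polynomials.coord) (simp add: coords_complex)

lemmas polynomials_proj =
  polynomials_ident
  polynomials_ident[THEN polynomials_fst]
  polynomials_ident[THEN polynomials_snd]
  polynomials_ident[THEN polynomials_fst, THEN polynomials_fst]
  polynomials_ident[THEN polynomials_fst, THEN polynomials_snd]
  polynomials_ident[THEN polynomials_snd, THEN polynomials_fst]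
  polynomials_ident[THEN polynomials_snd, THEN polynomials_snd]

lemmas polynomials_proj_fst = polynomials_proj[THEN polynomials_fst]
lemmas polynomials_proj_snd = polynomials_proj[THEN polynomials_snd]
lemmas polynomials_coordinates = polynomials_proj polynomials_proj_fst polynomials_proj_snd
  polynomials_proj_fst[THEN polynomials_snd] polynomials_proj_snd[THEN polynomials_snd]

lemma regular_map_total:
  assumes "p \<in> polynomials"
  shows "regular_map (\<lambda>v. Some (p v))"
  by (rule regular_map_Some[where g = p, OF polynomials.const[of 1]])
    (simp_all add: coords_complex regular_on_polynomial[OF assms])

section \<open>Restriction to the invariant leaves\<close>

lemma regular_map_T6: "regular_map (T6 a b c)"
proof -
  define x y z X Y Z :: "complex2 \<times> complex2 \<times> complex2 \<Rightarrow> complex" where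
    "x = (\<lambda>v. fst (fst v))" and "y = (\<lambda>v. fst (fst (snd v)))" and "z = (\<lambda>v. fst (snd (snd v)))"
    and "X = (\<lambda>v. snd (fst v))" and "Y = (\<lambda>v. snd (fst (snd v)))" and "Z = (\<lambda>v. snd (snd (snd v)))"
  define f where "f v = f_poly (x v) (y v) (z v)" for v
  define N where "N v = f v b a (X v) (Y v) (X v) * f v b c (X v) (Y v) (Z v)
      + f v b 0 (X v) (Y v) (-1) * x v * z v * X v ^ 2 * Y v * Z v" for v
  \<comment> \<open>The product of all quantities whose vanishing makes \<open>T6\<close> undefined.
    With \<open>a\<close> and \<open>c\<close> among the factors, the description of the domain is
    also correct for zero parameters.\<close>
  define d where "d v = a * c * x v * y v * z v * X v * Y v * Z v * N v" for v
  have proj: "x \<in> polynomials" "y \<in> polynomials" "z \<in> polynomials"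
    "X \<in> polynomials" "Y \<in> polynomials" "Z \<in> polynomials"
    unfolding x_def y_def z_def X_def Y_def Z_def by (rule polynomials_coordinates)+
  have f: "(\<lambda>v. f v \<beta> \<gamma> (X v) (Y v) (\<zeta> v)) \<in> polynomials" if "\<zeta> \<in> polynomials" for \<beta> \<gamma> \<zeta>
    unfolding f_def f_poly_def by (intro polynomials_intros proj that)
  have N: "N \<in> polynomials"
    unfolding N_def by (intro polynomials_intros proj f)
  have d: "d \<in> polynomials"
    unfolding d_def by (intro polynomials_intros proj N)
  define g where "g v = ((f v b c (X v) (Y v) (Z v) * N v / (a*c^2*x v * y v * z v^2*X v^2*Y v^2*Z v),
        a*c*x v * y v * z v * X v^2*Y v^2 / N v),
       (x v * y v * z v * X v * Y v * Z v * f v b 0 (X v) (Y v) (-1) / N v,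
        N v / (a*c*x v * y v * z v * X v * Y v)),
       (f v b a (X v) (Y v) (X v) / (a*x v * X v * Y v),
        a*c*x v * y v * z v * X v * Y v^2*Z v / N v))" for v
  have T: "T6 a b c v = (if d v = 0 then None else Some (g v))" for v
    by (simp add: g_def case_prod_beta T6_def Let_def N_def f_def d_def x_def y_def z_def X_def Y_def Z_def)
  have r4:
    "(\<lambda>v. f v b c (X v) (Y v) (Z v) * N v / (a*c^2*x v * y v * z v^2*X v^2*Y v^2*Z v)) \<in> regular_on d"
    by (rule regular_on_divide[where k = 2 and h = "\<lambda>v. a * x v * y v * Z v * N v ^ 2"])
      (auto intro!: polynomials_intros proj f N simp: d_def power2_eq_square)
  have r1: "(\<lambda>v. a*c*x v * y v * z v * X v^2*Y v^2 / N v) \<in> regular_on d"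
      "(\<lambda>v. x v * y v * z v * X v * Y v * Z v * f v b 0 (X v) (Y v) (-1) / N v) \<in> regular_on d"
      "(\<lambda>v. a*c*x v * y v * z v * X v * Y v^2*Z v / N v) \<in> regular_on d"
    by (rule regular_on_divide[where k = 1 and h = "\<lambda>v. a * c * x v * y v * z v * X v * Y v * Z v"],
      auto intro!: polynomials_intros proj f[of "\<lambda>_. -1"] N simp: d_def)+
  have r2: "(\<lambda>v. N v / (a*c*x v * y v * z v * X v * Y v)) \<in> regular_on d"
    by (rule regular_on_divide[where k = 1 and h = "\<lambda>v. Z v * N v"])
      (auto intro!: polynomials_intros proj N simp: d_def)
  have r3: "(\<lambda>v. f v b a (X v) (Y v) (X v) / (a*x v * X v * Y v)) \<in> regular_on d"
    by (rule regular_on_divide[where k = 1 and h = "\<lambda>v. c * y v * z v * Z v * N v"])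
      (auto intro!: polynomials_intros proj f N simp: d_def)
  show ?thesis
  proof (rule regular_map_Some[where g = g, OF d])
    show "T6 a b c v = (if d v = 0 then None else Some (g v))" for v by (rule T)
  next
    fix \<phi> :: "complex2 \<times> complex2 \<times> complex2 \<Rightarrow> complex" assume "\<phi> \<in> coords"
    then show "(\<lambda>v. \<phi> (g v)) \<in> regular_on d"
      by (elim coords_prodE, simp_all only: coords_complex simp_thms)
        (simp_all only: g_def fst_conv snd_conv, (rule r1 r2 r3 r4)+)
  qed
qed

lemma regular_map_T9: "regular_map T9"
proof -
  define x1 x2 X y1 y2 Y z1 z2 Z :: "complex3 \<times> complex3 \<times> complex3 \<Rightarrow> complex" where
    "x1 = (\<lambda>v. fst (fst v))" and "x2 = (\<lambda>v. fst (snd (fst v)))" and "X = (\<lambda>v. snd (snd (fst v)))"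
    and "y1 = (\<lambda>v. fst (fst (snd v)))" and "y2 = (\<lambda>v. fst (snd (fst (snd v))))"
    and "Y = (\<lambda>v. snd (snd (fst (snd v))))"
    and "z1 = (\<lambda>v. fst (snd (snd v)))" and "z2 = (\<lambda>v. fst (snd (snd (snd v))))"
    and "Z = (\<lambda>v. snd (snd (snd (snd v))))"
  note xyz_def = x1_def x2_def X_def y1_def y2_def Y_def z1_def z2_def Z_def
  define A B C E where "A v = x1 v * x2 v * X v - 1" and "B v = y1 v * y2 v * Y v - 1"
    and "C v = z1 v * z2 v * Z v - 1"
    and "E v = 1 + x2 v * y1 v * z2 v * Z v + B v * (x1 v * (x2 v + y2 v * z1 v * Y v)*X v + z1 v * z2 v * Z v)" for v
  define d where "d v = X v * Y v * Z v * A v * C v * E v" for v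
  have proj: "x1 \<in> polynomials" "x2 \<in> polynomials" "X \<in> polynomials" "y1 \<in> polynomials"
    "y2 \<in> polynomials" "Y \<in> polynomials" "z1 \<in> polynomials" "z2 \<in> polynomials" "Z \<in> polynomials"
    unfolding xyz_def by (rule polynomials_coordinates)+
  have ABC: "A \<in> polynomials" "B \<in> polynomials" "C \<in> polynomials"
    unfolding A_def B_def C_def by (intro polynomials_intros proj)+
  have E: "E \<in> polynomials"
    unfolding E_def by (intro polynomials_intros proj ABC)
  have d: "d \<in> polynomials"
    unfolding d_def by (intro polynomials_intros proj ABC E)
  define g where "g v = ((E v * (x1 v * X v * B v + y1 v * z2 v * Z v) * Y v / (A v * X v * C v^2 * Z v),
        (x2 v + y2 v * z1 v * Y v) * (Z v / Y v),
        A v * X v * C v / E v),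
       ((y1 v + x1 v * z1 v * X v * B v) / (E v * X v),
        A v * X v * (y2 v * Y v + x2 v * z2 v * Z v) * C v / (E v * Y v),
        E v * Y v / (A v * C v)),
       ((x2 v * y1 v + z1 v * B v) / A v,
        (x1 v * y2 v * X v * Y v + z2 v * Z v) * E v / (A v * C v * Z v),
        A v * C v * Z v / E v))" for v
  have T: "T9 v = (if d v = 0 then None else Some (g v))" for v
    by (simp add: g_def case_prod_beta T9_def Let_def A_def B_def C_def E_def d_def xyz_def)
  have r1: "(\<lambda>v. E v * (x1 v * X v * B v + y1 v * z2 v * Z v) * Y v / (A v * X v * C v^2 * Z v)) \<in> regular_on d"
    by (rule regular_on_divide[where k = 2 and h = "\<lambda>v. X v * Y v ^ 2 * Z v * A v * E v ^ 2"])
      (auto intro!: polynomials_intros proj ABC E simp: d_def power2_eq_square)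
  have "(\<lambda>v. (x2 v + y2 v * z1 v * Y v) * Z v / Y v) \<in> regular_on d"
    by (rule regular_on_divide[where k = 1 and h = "\<lambda>v. X v * Z v * A v * C v * E v"])
      (auto intro!: polynomials_intros proj ABC E simp: d_def)
  then have r2: "(\<lambda>v. (x2 v + y2 v * z1 v * Y v) * (Z v / Y v)) \<in> regular_on d"
    by simp
  have r3: "(\<lambda>v. A v * X v * C v / E v) \<in> regular_on d" "(\<lambda>v. A v * C v * Z v / E v) \<in> regular_on d"
    by (rule regular_on_divide[where k = 1 and h = "\<lambda>v. X v * Y v * Z v * A v * C v"],
      auto intro!: polynomials_intros proj ABC E simp: d_def)+
  have r4: "(\<lambda>v. (y1 v + x1 v * z1 v * X v * B v) / (E v * X v)) \<in> regular_on d"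
    by (rule regular_on_divide[where k = 1 and h = "\<lambda>v. Y v * Z v * A v * C v"])
      (auto intro!: polynomials_intros proj ABC E simp: d_def)
  have r5: "(\<lambda>v. A v * X v * (y2 v * Y v + x2 v * z2 v * Z v) * C v / (E v * Y v)) \<in> regular_on d"
    by (rule regular_on_divide[where k = 1 and h = "\<lambda>v. X v * Z v * A v * C v"])
      (auto intro!: polynomials_intros proj ABC E simp: d_def)
  have r6: "(\<lambda>v. E v * Y v / (A v * C v)) \<in> regular_on d"
    by (rule regular_on_divide[where k = 1 and h = "\<lambda>v. X v * Y v * Z v * E v"])
      (auto intro!: polynomials_intros proj ABC E simp: d_def)
  have r7: "(\<lambda>v. (x2 v * y1 v + z1 v * B v) / A v) \<in> regular_on d"
    by (rule regular_on_divide[where k = 1 and h = "\<lambda>v. X v * Y v * Z v * C v * E v"])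
      (auto intro!: polynomials_intros proj ABC E simp: d_def)
  have r8: "(\<lambda>v. (x1 v * y2 v * X v * Y v + z2 v * Z v) * E v / (A v * C v * Z v)) \<in> regular_on d"
    by (rule regular_on_divide[where k = 1 and h = "\<lambda>v. X v * Y v * E v"])
      (auto intro!: polynomials_intros proj ABC E simp: d_def)
  show ?thesis
  proof (rule regular_map_Some[where g = g, OF d])
    show "T9 v = (if d v = 0 then None else Some (g v))" for v by (rule T)
  next
    fix \<phi> :: "complex3 \<times> complex3 \<times> complex3 \<Rightarrow> complex" assume "\<phi> \<in> coords"
    then show "(\<lambda>v. \<phi> (g v)) \<in> regular_on d"
      by (elim coords_prodE, simp_all only: coords_complex simp_thms)
        (simp_all only: g_def fst_conv snd_conv, (rule r1 r2 r3 r4 r5 r6 r7 r8)+)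
  qed
qed

text \<open>The three quantities are \<open>- A * X\<close>, \<open>- B * Y\<close> and
  \<open>- C * Z\<close>. The claim reduces to evaluating \<open>u1 * u2 * U\<close>,
  \<open>v1 * v2 * V\<close> and \<open>w1 * w2 * W\<close>, and there the products of the
  numerators collapse to \<open>C + E\<close>, \<open>E + A * B * C\<close> and
  \<open>A + E\<close>.\<close>

lemma T9_invariants:
  assumes "T9 ((x1, x2, X), (y1, y2, Y), (z1, z2, Z)) = Some ((u1, u2, U), (v1, v2, V), (w1, w2, W))"
  shows "U - u1 * u2 * U^2 = X - x1 * x2 * X^2" (is ?U)
    and "V - v1 * v2 * V^2 = Y - y1 * y2 * Y^2" (is ?V)
    and "W - w1 * w2 * W^2 = Z - z1 * z2 * Z^2" (is ?W)
proof -
  define A B C where "A = x1 * x2 * X - 1" and "B = y1 * y2 * Y - 1" and "C = z1 * z2 * Z - 1"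
  define E where "E = 1 + x2*y1*z2*Z + B * (x1*(x2 + y2*z1*Y)*X + z1*z2*Z)"
  have nz: "X \<noteq> 0" "Y \<noteq> 0" "Z \<noteq> 0" "A \<noteq> 0" "C \<noteq> 0" "E \<noteq> 0"
    and out: "u1 = E * (x1*X*B + y1*z2*Z) * Y / (A * X * C^2 * Z)"
      "u2 = (x2 + y2*z1*Y) * (Z / Y)" "U = A * X * C / E"
      "v1 = (y1 + x1*z1*X*B) / (E*X)" "v2 = A * X * (y2*Y + x2*z2*Z) * C / (E*Y)"
      "V = E*Y / (A * C)" "w1 = (x2*y1 + z1*B) / A"
      "w2 = (x1*y2*X*Y + z2*Z) * E / (A * C * Z)" "W = A * C * Z / E"
    using assms unfolding T9_def Let_def A_def B_def C_def E_def by (auto split: if_splits)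
  have "u1 * u2 * U = (x1*X*B + y1*z2*Z) * (x2 + y2*z1*Y) / C"
    using nz by (simp add: out field_simps power2_eq_square)
  moreover have "(x1*X*B + y1*z2*Z) * (x2 + y2*z1*Y) = C + E"
    unfolding E_def B_def C_def by algebra
  ultimately have "u1 * u2 * U = 1 + E / C"
    using nz by (simp add: field_simps)
  then have "U * (1 - u1 * u2 * U) = U * (- (E / C))" by simp
  also have "\<dots> = - (A * X)"
    using nz by (simp add: out(3))
  finally have "U * (1 - u1 * u2 * U) = - (A * X)" .
  then show ?U by (simp add: A_def power2_eq_square algebra_simps)
  have "v1 * v2 * V = (y1 + x1*z1*X*B) * (y2*Y + x2*z2*Z) / E"
    using nz by (simp add: out field_simps)
  moreover have "(y1 + x1*z1*X*B) * (y2*Y + x2*z2*Z) = E + A * B * C"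
    unfolding E_def A_def B_def C_def by algebra
  ultimately have "v1 * v2 * V = 1 + A * B * C / E"
    using nz by (simp add: field_simps)
  then have "V * (1 - v1 * v2 * V) = V * (- (A * B * C / E))" by simp
  also have "\<dots> = - (B * Y)"
    using nz by (simp add: out(6))
  finally have "V * (1 - v1 * v2 * V) = - (B * Y)" .
  then show ?V by (simp add: B_def power2_eq_square algebra_simps)
  have "w1 * w2 * W = (x2*y1 + z1*B) * (x1*y2*X*Y + z2*Z) / A"
    using nz by (simp add: out field_simps)
  moreover have "(x2*y1 + z1*B) * (x1*y2*X*Y + z2*Z) = A + E"
    unfolding E_def A_def B_def by algebra
  ultimately have "w1 * w2 * W = 1 + E / A"
    using nz by (simp add: field_simps)
  then have "W * (1 - w1 * w2 * W) = W * (- (E / A))" by simp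
  also have "\<dots> = - (C * Z)"
    using nz by (simp add: out(9))
  finally have "W * (1 - w1 * w2 * W) = - (C * Z)" .
  then show ?W by (simp add: C_def power2_eq_square algebra_simps)
qed

text \<open>On this slice the lower-left Lax entries vanish and \<open>N\<close> becomes the
  monomial \<open>a^2 * b^2 * c * x * y * z\<close>, so all denominators are nonzero. It supplies
  the points at which \<open>T6\<close> and its composites are shown to be defined.\<close>

lemma T6_upper_triangular:
  assumes "a \<noteq> 0" "b \<noteq> 0" "c \<noteq> 0" "x \<noteq> 0" "y \<noteq> 0" "z \<noteq> 0"
  shows "T6 a b c ((x, a), (y, b), (z, c)) = Some ((b * x / c, a), ((y - a * x * z) / a, b), (z, c))"
proof -
  have "f_poly x y z b a a b a * f_poly x y z b c a b c +
      f_poly x y z b 0 a b (-1) * x * z * a^2 * b * c = a^2 * b^2 * c * x * y * z"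
    by (simp add: f_poly_def power2_eq_square algebra_simps)
  then show ?thesis
    using assms unfolding T6_def Let_def
    by (simp add: f_poly_def field_simps power2_eq_square)
qed

text \<open>The domain of \<open>T6\<close> serves as the generic set. There each leaf equation is
  linear in \<open>x2\<close>, \<open>y2\<close> or \<open>z2\<close> with nonzero leading
  coefficient, so the leaf point over \<open>r\<close> is unique. Inserting it turns
  \<open>A\<close>, \<open>B\<close>, \<open>C\<close> into \<open>- a / X\<close>,
  \<open>- b / Y\<close>, \<open>- c / Z\<close> and \<open>E\<close> into \<open>N\<close> divided
  by a monomial, after which the two formulas agree componentwise.\<close>

lemma restricts_to_leaf:
  assumes abc: "a \<noteq> 0" "b \<noteq> 0" "c \<noteq> 0"
  shows "restricts_to T9 (leaf a \<times> leaf b \<times> leaf c) leaf_coords (T6 a b c)"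
  unfolding restricts_to_def
proof (intro conjI ballI allI impI)
  fix p p' assume *: "p \<in> leaf a \<times> leaf b \<times> leaf c" "T9 p = Some p'"
  obtain x1 x2 X y1 y2 Y z1 z2 Z where p: "p = ((x1, x2, X), (y1, y2, Y), (z1, z2, Z))"
    by (metis surj_pair)
  obtain u1 u2 U v1 v2 V w1 w2 W where p': "p' = ((u1, u2, U), (v1, v2, V), (w1, w2, W))"
    by (metis surj_pair)
  show "p' \<in> leaf a \<times> leaf b \<times> leaf c"
    using * T9_invariants[OF *(2)[unfolded p p']] by (auto simp: p p' leaf_def)
next
  show "generically (\<lambda>r. (\<exists>!p. p \<in> leaf a \<times> leaf b \<times> leaf c \<and> leaf_coords p = r) \<and>
    (\<forall>p\<in>leaf a \<times> leaf b \<times> leaf c. leaf_coords p = r \<longrightarrow>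
      (\<exists>p'. T9 p = Some p' \<and> T6 a b c r = Some (leaf_coords p'))))"
  proof (rule genericallyI[OF regular_map_T6])
    show "T6 a b c ((1, a), (1, b), (1, c)) \<noteq> None"
      using abc by (simp add: T6_upper_triangular)
  next
    fix r assume r0: "T6 a b c r \<noteq> None"
    obtain x1 X y1 Y z1 Z where r: "r = ((x1, X), (y1, Y), (z1, Z))"
      by (metis surj_pair)
    define f where "f = f_poly x1 y1 z1"
    define N where "N = f b a X Y X * f b c X Y Z + f b 0 X Y (-1) * x1*z1*X^2*Y*Z"
    have nz: "x1 \<noteq> 0" "y1 \<noteq> 0" "z1 \<noteq> 0" "X \<noteq> 0" "Y \<noteq> 0" "Z \<noteq> 0" "N \<noteq> 0"
      using r0 unfolding T6_def Let_def r N_def f_def by (auto split: if_splits)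
    define x2 y2 z2 where "x2 = (X - a) / (x1 * X^2)" and "y2 = (Y - b) / (y1 * Y^2)"
      and "z2 = (Z - c) / (z1 * Z^2)"
    define p where "p = ((x1, x2, X), (y1, y2, Y), (z1, z2, Z))"
    have p: "p \<in> leaf a \<times> leaf b \<times> leaf c" "leaf_coords p = r"
      using nz by (auto simp: p_def leaf_def leaf_coords_def r x2_def y2_def z2_def)
    have unique: "q = p" if "q \<in> leaf a \<times> leaf b \<times> leaf c" "leaf_coords q = r" for q
    proof -
      have solve: "s = (\<xi> - \<alpha>) / (\<eta> * \<xi>^2)" if "\<xi> - \<eta> * s * \<xi>^2 = \<alpha>" "\<eta> \<noteq> 0" "\<xi> \<noteq> 0" for s \<xi> \<eta> \<alpha> :: complex
        using that by auto
      show ?thesis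
        using that nz solve unfolding p_def x2_def y2_def z2_def r leaf_def leaf_coords_def
        by (cases q) auto
    qed
    define A B C where "A = x1 * x2 * X - 1" and "B = y1 * y2 * Y - 1" and "C = z1 * z2 * Z - 1"
    define E where "E = 1 + x2*y1*z2*Z + B * (x1*(x2 + y2*z1*Y)*X + z1*z2*Z)"
    have A: "A = - a / X" and B: "B = - b / Y" and C: "C = - c / Z"
      using nz by (simp_all add: A_def B_def C_def x2_def y2_def z2_def field_simps power2_eq_square)
    have E: "E = N / (x1 * y1 * z1 * X^2 * Y^2 * Z)"
    proof -
      have eqs: "a = X - x1 * x2 * X^2" "b = Y - y1 * y2 * Y^2" "c = Z - z1 * z2 * Z^2"
        using nz by (simp_all add: x2_def y2_def z2_def)
      have "E * (x1 * y1 * z1 * X^2 * Y^2 * Z) = N"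
        unfolding E_def B_def N_def f_def f_poly_def eqs by algebra
      then show ?thesis
        using nz by (simp add: eq_divide_eq)
    qed
    have "T9 p = Some ((E * (x1*X*B + y1*z2*Z) * Y / (A * X * C^2 * Z),
        (x2 + y2*z1*Y) * (Z / Y), A * X * C / E),
       ((y1 + x1*z1*X*B) / (E*X), A * X * (y2*Y + x2*z2*Z) * C / (E*Y), E*Y / (A * C)),
       ((x2*y1 + z1*B) / A, (x1*y2*X*Y + z2*Z) * E / (A * C * Z), A * C * Z / E))"
    proof -
      have "A \<noteq> 0" "C \<noteq> 0" "E \<noteq> 0"
        using nz abc by (simp_all add: A C E)
      then show ?thesis
        using nz unfolding p_def T9_def Let_def A_def B_def C_def E_def by simp
    qed
    moreover have "E * (x1*X*B + y1*z2*Z) * Y / (A * X * C^2 * Z) =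
        f b c X Y Z * N / (a*c^2*x1*y1*z1^2*X^2*Y^2*Z)"
      using nz abc by (simp add: A B C E f_def f_poly_def z2_def field_simps power2_eq_square)
    moreover have "A * X * C / E = a*c*x1*y1*z1*X^2*Y^2 / N"
      using nz abc by (simp add: A C E field_simps power2_eq_square)
    moreover have "(y1 + x1*z1*X*B) / (E*X) = x1*y1*z1*X*Y*Z * f b 0 X Y (-1) / N"
      using nz abc by (simp add: B E f_def f_poly_def field_simps power2_eq_square)
    moreover have "E*Y / (A * C) = N / (a*c*x1*y1*z1*X*Y)"
      using nz abc by (simp add: A C E field_simps power2_eq_square)
    moreover have "(x2*y1 + z1*B) / A = f b a X Y X / (a*x1*X*Y)"
      using nz abc by (simp add: A B x2_def f_def f_poly_def field_simps power2_eq_square)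
    moreover have "A * C * Z / E = a*c*x1*y1*z1*X*Y^2*Z / N"
      using nz abc by (simp add: A C E field_simps power2_eq_square)
    ultimately have "\<exists>p'. T9 p = Some p' \<and> T6 a b c r = Some (leaf_coords p')"
      using nz abc unfolding r T6_def Let_def leaf_coords_def N_def f_def by simp
    then show "(\<exists>!p. p \<in> leaf a \<times> leaf b \<times> leaf c \<and> leaf_coords p = r) \<and>
      (\<forall>p\<in>leaf a \<times> leaf b \<times> leaf c. leaf_coords p = r \<longrightarrow>
        (\<exists>p'. T9 p = Some p' \<and> T6 a b c r = Some (leaf_coords p')))"
      using p unique by blast
  qed
qed

section \<open>Refactorisation of Lax matrices\<close>

lemma T6_products:
  assumes "T6 a b c ((x1, X), (y1, Y), (z1, Z)) = Some ((u1, U), (v1, V), (w1, W))"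
  shows "U * V = X * Y" and "V * W = Y * Z" and "U \<noteq> 0" "V \<noteq> 0" "W \<noteq> 0"
    and "x1 \<noteq> 0" "y1 \<noteq> 0" "z1 \<noteq> 0" "X \<noteq> 0" "Y \<noteq> 0" "Z \<noteq> 0"
  using assms unfolding T6_def Let_def
  by (auto split: if_splits simp: power2_eq_square)

text \<open>
  With \<open>p\<close>, \<open>q\<close> and \<open>s\<close>, \<open>r\<close> the off-diagonal entries of the Lax matrices, these are seven of the nine
  entries of the refactorisation identity. Nonvanishing of \<open>u1\<close>, \<open>v1\<close>, \<open>w1\<close> is needed because the
  entries \<open>s\<close> are quotients by them.
\<close>

lemma T6_relations:
  assumes T: "T6 a b c ((x1, X), (y1, Y), (z1, Z)) = Some ((u1, U), (v1, V), (w1, W))"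
    and nz: "u1 \<noteq> 0" "v1 \<noteq> 0" "w1 \<noteq> 0"
  defines "p1 \<equiv> (X - a) / (x1 * X)" and "p2 \<equiv> (Y - b) / (y1 * Y)" and "p3 \<equiv> (Z - c) / (z1 * Z)"
    and "s1 \<equiv> (U - a) / (u1 * U)" and "s2 \<equiv> (V - b) / (v1 * V)" and "s3 \<equiv> (W - c) / (w1 * W)"
    and "q1 \<equiv> x1 * X" and "q2 \<equiv> y1 * Y" and "q3 \<equiv> z1 * Z"
    and "r1 \<equiv> u1 * U" and "r2 \<equiv> v1 * V" and "r3 \<equiv> w1 * W"
  shows "s2 = p3 * p1 + p2 * X"
    and "s3 = p3 + p2 * q1"
    and "U * r2 * s3 + r1 * W = Y * q1"
    and "U * r2 + r1 * r3 = q2"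
    and "s1 * V = Z * p1 + q3 * p2 * X"
    and "s1 * r2 * s3 + W = Z + q3 * p2 * q1"
    and "s1 * r2 + r3 = q3"
proof -
  define f where "f = f_poly x1 y1 z1"
  define N where "N = f b a X Y X * f b c X Y Z + f b 0 X Y (-1) * x1*z1*X^2*Y*Z"
  have nz0: "a \<noteq> 0" "c \<noteq> 0" "x1 \<noteq> 0" "y1 \<noteq> 0" "z1 \<noteq> 0" "X \<noteq> 0" "Y \<noteq> 0" "Z \<noteq> 0" "N \<noteq> 0"
    using T unfolding T6_def Let_def N_def f_def by (auto split: if_splits)
  have out: "u1 = f b c X Y Z * N / (a*c^2*x1*y1*z1^2*X^2*Y^2*Z)" "U = a*c*x1*y1*z1*X^2*Y^2 / N"
    "v1 = x1*y1*z1*X*Y*Z * f b 0 X Y (-1) / N" "V = N / (a*c*x1*y1*z1*X*Y)"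
    "w1 = f b a X Y X / (a*x1*X*Y)" "W = a*c*x1*y1*z1*X*Y^2*Z / N"
    using T unfolding T6_def Let_def N_def f_def by (auto split: if_splits)
  have s_def: "s1 = (U - a) / r1" "s2 = (V - b) / r2" "s3 = (W - c) / r3"
    by (simp_all add: s1_def s2_def s3_def r1_def r2_def r3_def)
  have qnz: "q1 \<noteq> 0" "q2 \<noteq> 0" "q3 \<noteq> 0"
    using nz0 by (simp_all add: q1_def q2_def q3_def)
  \<comment> \<open>The parameters are the determinants of the Lax matrices. Eliminating them leaves
    the Lax entries as free variables, in which the required identities are polynomial.\<close>
  have a: "a = X - p1 * q1" and b: "b = Y - p2 * q2" and c: "c = Z - p3 * q3"
    using nz0 by (simp_all add: p1_def p2_def p3_def q1_def q2_def q3_def)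
  have x1: "x1 = q1 / X" and y1: "y1 = q2 / Y" and z1: "z1 = q3 / Z"
    using nz0 by (simp_all add: q1_def q2_def q3_def)
  \<comment> \<open>The three polynomials \<open>f\<close> and \<open>N\<close>, expressed in Lax
    entries and stripped of monomial factors. The entries \<open>r1\<close>, \<open>r2\<close>,
    \<open>r3\<close>, \<open>U\<close>, \<open>V\<close>, \<open>W\<close> become short fractions
    in them, so each relation comes down to one polynomial identity.\<close>
  define F G H M where "F = b * q1 - p3 * q2" and "G = b * q3 * X - p1 * q2 * Z"
    and "H = q2 * Z - b * q1 * q3" and "M = a * b * c + H * (p3 * p1 + p2 * X)"
  have F: "f b c X Y Z = q3 * F" and G: "f b a X Y X = q1 * G / Z" and H: "f b 0 X Y (-1) = H / Z"
    using nz0 by (simp_all add: f_def f_poly_def F_def G_def H_def x1 y1 z1 c a field_simps)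
  have "N * Z = q1 * q3 * (G * F + H * X * Y)"
    using nz0 by (simp add: N_def F G H x1 z1 power2_eq_square field_simps)
  moreover have "G * F + H * X * Y = q2 * M"
    unfolding F_def G_def H_def M_def a b c by algebra
  ultimately have N: "N = q1 * q2 * q3 * M / Z"
    using nz0 by (simp add: eq_divide_eq)
  have M: "M \<noteq> 0"
    using nz0 by (auto simp: N)
  have V: "V = M / (a * c)"
    using nz0 qnz by (simp add: out N x1 y1 z1)
  have UV: "U * V = X * Y" and VW: "V * W = Y * Z" and U0: "U \<noteq> 0" and V0: "V \<noteq> 0" and W0: "W \<noteq> 0"
    using T6_products[OF T] by auto
  have U: "U = X * Y * a * c / M" and W: "W = Y * Z * a * c / M"
    using UV VW V V0 M nz0 by (simp_all add: field_simps)
  have r1: "r1 = F / c" and r2: "r2 = H / (a * c)" and r3: "r3 = G * c / M"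
    unfolding r1_def r2_def r3_def out F G H using nz0 qnz M
    by (simp_all add: N x1 y1 z1 field_simps power2_eq_square)
  have "r1 \<noteq> 0" "r2 \<noteq> 0" "r3 \<noteq> 0"
    using nz U0 V0 W0 by (simp_all add: r1_def r2_def r3_def)
  then have FGH: "F \<noteq> 0" "G \<noteq> 0" "H \<noteq> 0"
    using r1 r2 r3 by auto
  have "M - a * b * c = H * (p3 * p1 + p2 * X)" by (simp add: M_def)
  then show s2: "s2 = p3 * p1 + p2 * X"
    unfolding s_def(2) unfolding r2 V using nz0 FGH by (simp add: field_simps)
  have "a * Y * Z - M = G * (p3 + p2 * q1)"
    unfolding F_def G_def H_def M_def a b c by algebra
  then show s3: "s3 = p3 + p2 * q1"
    unfolding s_def(3) unfolding r3 W using nz0 FGH M by (simp add: divide_simps) algebra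
  have *: "X * Y * c - M = F * (Z * p1 + q3 * p2 * X)"
    unfolding F_def G_def H_def M_def a b c by algebra
  show s1: "s1 * V = Z * p1 + q3 * p2 * X"
    unfolding s_def(1) unfolding r1 U V using nz0 FGH M *
    by (simp add: divide_simps) algebra
  \<comment> \<open>With \<open>V\<close> known, the relation just shown gives \<open>s1\<close>
    without a division by \<open>r1\<close>.\<close>
  have s1': "s1 = (Z * p1 + q3 * p2 * X) * a * c / M"
    using s1 V V0 nz0 M by (simp add: field_simps)
  have "X * H * s3 + a * F * Z = q1 * M"
    unfolding F_def G_def H_def M_def a b c s3 by algebra
  then show "U * r2 * s3 + r1 * W = Y * q1"
    unfolding U W r1 r2 using nz0 M by (simp add: divide_simps) algebra
  show "U * r2 + r1 * r3 = q2"
    unfolding U r1 r2 r3 using nz0 M \<open>G * F + H * X * Y = q2 * M\<close>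
    by (simp add: divide_simps) algebra
  have "(Z * p1 + q3 * p2 * X) * H * s3 + a * c * Y * Z = (Z + q3 * p2 * q1) * M"
    unfolding F_def G_def H_def M_def a b c s3 by algebra
  then show "s1 * r2 * s3 + W = Z + q3 * p2 * q1"
    unfolding s1' r2 W using nz0 M by (simp add: divide_simps) algebra
  have "(Z * p1 + q3 * p2 * X) * H + c * G = q3 * M"
    unfolding F_def G_def H_def M_def a b c s3 by algebra
  then show "s1 * r2 + r3 = q3"
    unfolding s1' r2 r3 using nz0 M by (simp add: divide_simps) algebra
qed

section \<open>Lax operators and uniqueness of factorisations\<close>

definition nonzero :: "complex2 \<Rightarrow> bool" where
  "nonzero r \<longleftrightarrow> fst r \<noteq> 0 \<and> snd r \<noteq> 0"

text \<open>An operator on coordinate vectors rather than a matrix: placing the 2 by 2 block at any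
  pair of indices is then a function update, and products are compositions.\<close>

definition lax :: "complex \<Rightarrow> 'i \<Rightarrow> 'i \<Rightarrow> complex2 \<Rightarrow> ('i \<Rightarrow> complex) \<Rightarrow> ('i \<Rightarrow> complex)" where
  "lax a i j = (\<lambda>(x, X) \<xi>. \<xi>(i := X * \<xi> i + x * X * \<xi> j, j := (X - a) / (x * X) * \<xi> i + \<xi> j))"

lemma lax_commute:
  assumes "{i, j} \<inter> {k, l} = {}"
  shows "lax a i j r (lax b k l s \<xi>) = lax b k l s (lax a i j r \<xi>)"
  using assms by (auto simp: lax_def fun_eq_iff split: prod.splits)

lemma lax_other:
  assumes "k \<noteq> i" "k \<noteq> j"
  shows "lax a i j r \<xi> k = \<xi> k"
  using assms by (simp add: lax_def split: prod.splits)

lemma lax_unit_vector: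
  assumes "k \<noteq> i" "k \<noteq> j"
  shows "lax a i j r ((\<lambda>_. 0)(k := 1)) = (\<lambda>_. 0)(k := 1)"
  using assms by (auto simp: lax_def fun_eq_iff split: prod.splits)

lemma bij_lax:
  assumes "i \<noteq> j" "a \<noteq> 0" "nonzero r"
  shows "bij (lax a i j r)"
proof -
  obtain x X where r: "r = (x, X)" by (cases r)
  define q p where "q = x * X" and "p = (X - a) / (x * X)"
  have X: "X = a + p * q"
    using assms by (simp add: r q_def p_def nonzero_def)
  \<comment> \<open>The adjugate matrix divided by the determinant \<open>a\<close>.\<close>
  define g where "g \<xi> = \<xi>(i := (\<xi> i - q * \<xi> j) / a, j := (X * \<xi> j - p * \<xi> i) / a)" for \<xi> :: "'a \<Rightarrow> complex"
  have l: "lax a i j r \<xi> = \<xi>(i := X * \<xi> i + q * \<xi> j, j := p * \<xi> i + \<xi> j)" for \<xi>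
    by (simp add: lax_def r p_def q_def)
  have "g (lax a i j r \<xi>) = \<xi>" "lax a i j r (g \<xi>) = \<xi>" for \<xi>
    using assms(1,2) by (auto simp: l g_def fun_eq_iff X field_simps)
  then show ?thesis
    by (intro o_bij[of g]) (auto simp: fun_eq_iff)
qed

text \<open>The prescribed coordinates are \<open>t\<close> times the second column of the inverse
  Lax matrix.\<close>

lemma lax_unit_preimage:
  assumes "i \<noteq> k" "a \<noteq> 0" "nonzero (x, X)" "\<xi> i = 0"
  shows "lax a i k (x, X) (\<xi>(i := - (x * X) * t / a, k := X * t / a)) = \<xi>(k := t)"
proof -
  have "(X - a) / (x * X) * (- (x * X) * t / a) + X * t / a = t"
    using assms(2,3) by (simp add: nonzero_def field_simps)
  then show ?thesis
    using assms by (auto simp: lax_def fun_eq_iff nonzero_def)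
qed

text \<open>The factors are inverted from the outermost inwards by \<open>lax_unit_preimage\<close>.
  Each leaves its negated upper-right entry, suitably scaled, at its own index and passes a rescaled
  coordinate \<open>k\<close> on to the next.\<close>

lemma lax_column:
  assumes dist: "distinct [i, j, l, k]" and par: "a \<noteq> 0" "b \<noteq> 0" "c \<noteq> 0"
    and nz: "nonzero (x, X)" "nonzero (y, Y)" "nonzero (z, Z)"
  shows "lax a i k (x, X) (lax b j k (y, Y) (lax c l k (z, Z) ((\<lambda>_. 0)(i := - (x * X) / a,
    j := - (y * Y) * (X / a) / b, l := - (z * Z) * (Y * (X / a) / b) / c, k := Z * (Y * (X / a) / b) / c))))
    = (\<lambda>_. 0)(k := 1)"
proof -
  let ?\<xi> = "(\<lambda>_. 0)(i := - (x * X) / a)"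
  have "i \<noteq> k" using dist by simp
  have z: "lax c l k (z, Z) (?\<xi>(j := - (y * Y) * (X / a) / b, l := - (z * Z) * (Y * (X / a) / b) / c,
      k := Z * (Y * (X / a) / b) / c)) = ?\<xi>(j := - (y * Y) * (X / a) / b, k := Y * (X / a) / b)"
    using dist par nz by (intro lax_unit_preimage) auto
  have y: "lax b j k (y, Y) (?\<xi>(j := - (y * Y) * (X / a) / b, k := Y * (X / a) / b)) = ?\<xi>(k := X / a)"
    using dist par nz by (intro lax_unit_preimage) auto
  have x: "lax a i k (x, X) (?\<xi>(k := X / a)) = (\<lambda>_. 0)(k := 1)"
    using lax_unit_preimage[OF _ par(1) nz(1), of i k "\<lambda>_. 0" 1] \<open>i \<noteq> k\<close>
    by (simp only: mult_1_right simp_thms)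
  show ?thesis
    unfolding z y x ..
qed

text \<open>
  The coordinate \<open>k\<close> of the product gives the lower-left entries. The vector that the product maps
  to the \<open>k\<close>-th basis vector (see \<open>lax_column\<close>) then gives the others one after the other.
\<close>

lemma lax_peel:
  fixes i j k l :: 'i
  assumes dist: "distinct [i, j, l, k]" and par: "a \<noteq> 0" "b \<noteq> 0" "c \<noteq> 0"
    and nz: "nonzero r" "nonzero s" "nonzero t" "nonzero r'" "nonzero s'" "nonzero t'"
    and F: "inj F" "\<And>\<xi>. F \<xi> k = \<xi> k" "F ((\<lambda>_. 0)(k := 1)) = (\<lambda>_. 0)(k := 1)"
    and F': "\<And>\<xi>. F' \<xi> k = \<xi> k" "F' ((\<lambda>_. 0)(k := 1)) = (\<lambda>_. 0)(k := 1)"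
    and eq: "\<And>\<xi>. F (lax a i k r (lax b j k s (lax c l k t \<xi>))) =
      F' (lax a i k r' (lax b j k s' (lax c l k t' \<xi>)))"
  shows "r = r' \<and> s = s' \<and> t = t' \<and> F = F'"
proof -
  obtain x X y Y z Z where r: "r = (x, X)" "s = (y, Y)" "t = (z, Z)"
    by (metis surj_pair)
  obtain x' X' y' Y' z' Z' where r': "r' = (x', X')" "s' = (y', Y')" "t' = (z', Z')"
    by (metis surj_pair)
  define B where "B \<xi> = lax a i k r (lax b j k s (lax c l k t \<xi>))" for \<xi>
  define B' where "B' \<xi> = lax a i k r' (lax b j k s' (lax c l k t' \<xi>))" for \<xi>
  have B: "B = lax a i k r \<circ> lax b j k s \<circ> lax c l k t"
    and B': "B' = lax a i k r' \<circ> lax b j k s' \<circ> lax c l k t'"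
    by (auto simp: B_def B'_def)
  have FB: "F (B \<xi>) = F' (B' \<xi>)" for \<xi>
    using eq by (simp add: B_def B'_def)
  have "bij B"
    unfolding B using dist par nz by (intro bij_comp bij_lax) auto
  have inj: "inj B"
    using \<open>bij B\<close> by (rule bij_is_inj)
  define p1 p2 p3 where "p1 = (X - a) / (x * X)" and "p2 = (Y - b) / (y * Y)" and "p3 = (Z - c) / (z * Z)"
  define p1' p2' p3' where "p1' = (X' - a) / (x' * X')" and "p2' = (Y' - b) / (y' * Y')"
    and "p3' = (Z' - c) / (z' * Z')"
  have nz': "x \<noteq> 0" "y \<noteq> 0" "z \<noteq> 0" "x' \<noteq> 0" "y' \<noteq> 0" "z' \<noteq> 0" "X \<noteq> 0" "Y \<noteq> 0" "Z \<noteq> 0"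
    "X' \<noteq> 0" "Y' \<noteq> 0" "Z' \<noteq> 0"
    using nz by (auto simp: nonzero_def r r')
  have X: "X = a + p1 * (x * X)" "Y = b + p2 * (y * Y)" "Z = c + p3 * (z * Z)"
    "X' = a + p1' * (x' * X')" "Y' = b + p2' * (y' * Y')" "Z' = c + p3' * (z' * Z')"
    using nz' by (simp_all add: p1_def p2_def p3_def p1'_def p2'_def p3'_def)
  \<comment> \<open>\<open>F\<close> and \<open>F'\<close> preserve coordinate \<open>k\<close>, so
    this linear form, whose coefficients are the lower-left entries, is the same for
    \<open>B\<close> and \<open>B'\<close>.\<close>
  have "B \<xi> k = p1 * \<xi> i + p2 * \<xi> j + p3 * \<xi> l + \<xi> k"
       "B' \<xi> k = p1' * \<xi> i + p2' * \<xi> j + p3' * \<xi> l + \<xi> k" for \<xi>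
    using dist by (auto simp: B_def B'_def lax_def r r' p1_def p2_def p3_def p1'_def p2'_def p3'_def)
  then have row: "p1 * \<xi> i + p2 * \<xi> j + p3 * \<xi> l = p1' * \<xi> i + p2' * \<xi> j + p3' * \<xi> l" for \<xi>
    using F(2)[of "B \<xi>"] F'(1)[of "B' \<xi>"] by (simp add: FB)
  have p: "p1 = p1'" "p2 = p2'" "p3 = p3'"
    using row[of "(\<lambda>_. 0)(i := 1)"] row[of "(\<lambda>_. 0)(j := 1)"] row[of "(\<lambda>_. 0)(l := 1)"] dist by auto
  define \<zeta> where "\<zeta> = (\<lambda>_. 0)(i := - (x * X) / a,
    j := - (y * Y) * (X / a) / b, l := - (z * Z) * (Y * (X / a) / b) / c, k := Z * (Y * (X / a) / b) / c)"
  define \<zeta>' where "\<zeta>' = (\<lambda>_. 0)(i := - (x' * X') / a,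
    j := - (y' * Y') * (X' / a) / b, l := - (z' * Z') * (Y' * (X' / a) / b) / c, k := Z' * (Y' * (X' / a) / b) / c)"
  have 1: "B \<zeta> = (\<lambda>_. 0)(k := 1)" and 2: "B' \<zeta>' = (\<lambda>_. 0)(k := 1)"
    using lax_column[OF dist par] nz unfolding B_def B'_def \<zeta>_def \<zeta>'_def r r' by metis+
  \<comment> \<open>Both sides are the \<open>k\<close>-th basis vector: on the right,
    \<open>F (B \<zeta>')\<close> equals \<open>F' (B' \<zeta>')\<close>, and \<open>F'\<close>
    fixes that vector. Injectivity of \<open>F\<close> and \<open>B\<close> then identifies the two
    preimages.\<close>
  have "F (B \<zeta>) = F (B \<zeta>')"
    using FB[of \<zeta>'] by (simp add: 1 2 F(3) F'(2))
  then have "\<zeta> = \<zeta>'"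
    using inj F(1) by (metis injD)
  then have \<zeta>: "\<zeta> m = \<zeta>' m" for m by simp
  \<comment> \<open>Each coordinate carries the diagonal entries of the factors before it, so the
    comparison must run in the order \<open>i\<close>, \<open>j\<close>, \<open>l\<close>. The
    determinant relation \<open>X = a + p1 * (x * X)\<close> and its analogues recover the diagonal
    entry from the off-diagonal ones.\<close>
  have q1: "x * X = x' * X'"
    using \<zeta>[of i] dist par by (simp add: \<zeta>_def \<zeta>'_def)
  then have X1: "X = X'"
    using X(1,4) p(1) by simp
  have q2: "y * Y = y' * Y'"
    using \<zeta>[of j] dist par nz' X1 by (simp add: \<zeta>_def \<zeta>'_def)
  then have X2: "Y = Y'"
    using X(2,5) p(2) by simp
  have q3: "z * Z = z' * Z'"
    using \<zeta>[of l] dist par nz' X1 X2 by (simp add: \<zeta>_def \<zeta>'_def)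
  then have X3: "Z = Z'"
    using X(3,6) p(3) by simp
  have rst: "r = r'" "s = s'" "t = t'"
    using q1 q2 q3 X1 X2 X3 nz' by (auto simp: r r')
  then have "F \<circ> B = F' \<circ> B"
    using FB by (auto simp: B_def B'_def fun_eq_iff)
  then have "F = F'"
    using \<open>bij B\<close> by (metis bij_is_surj comp_assoc comp_id surj_iff)
  with rst show ?thesis by simp
qed

text \<open>The six factors of the vector correspond to the edges 12, 13, 23, 14, 24, 34 of a
  tetrahedron with vertices 1 to 4. The index triples 123, 145, 246, 356 in the tetrahedron equation
  are then the edge sets of the faces 123, 124, 134, 234.\<close>

definition word :: "complex \<Rightarrow> complex \<Rightarrow> complex \<Rightarrow> complex \<Rightarrow> complex \<Rightarrow> complex \<Rightarrow>
    complex2 ^ 6 \<Rightarrow> (nat \<Rightarrow> complex) \<Rightarrow> (nat \<Rightarrow> complex)" where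
  "word a b c d e f v \<xi> = lax a 1 2 (v $ 1) (lax b 1 3 (v $ 2) (lax c 2 3 (v $ 3)
     (lax d 1 4 (v $ 4) (lax e 2 4 (v $ 5) (lax f 3 4 (v $ 6) \<xi>)))))"

lemma exhaust_6:
  fixes x :: 6
  shows "x = 1 \<or> x = 2 \<or> x = 3 \<or> x = 4 \<or> x = 5 \<or> x = 6"
proof (induct x)
  case (of_int z)
  then have "z = 0 \<or> z = 1 \<or> z = 2 \<or> z = 3 \<or> z = 4 \<or> z = 5" by fastforce
  then show ?case by auto
qed

text \<open>Three rounds of \<open>lax_peel\<close>, with last index 4, 3 and 2, remove the edges
  ending at that vertex.\<close>

lemma word_inj:
  assumes par: "a \<noteq> 0" "b \<noteq> 0" "c \<noteq> 0" "d \<noteq> 0" "e \<noteq> 0" "f \<noteq> 0"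
    and nz: "\<And>m. nonzero (v $ m)" "\<And>m. nonzero (w $ m)"
    and eq: "word a b c d e f v = word a b c d e f w"
  shows "v = w"
proof -
  \<comment> \<open>A filler for the later rounds, where fewer than three factors remain. With
    parameter 1 it gives an invertible Lax operator, attached identically to both sides at indices
    no longer in use.\<close>
  define u :: complex2 where "u = (1, 1)"
  have u: "nonzero u" by (simp add: nonzero_def u_def)
  define F3 where "F3 v = lax a (1::nat) 2 (v $ 1) \<circ> lax b 1 3 (v $ 2) \<circ> lax c 2 3 (v $ 3)"
    for v :: "complex2 ^ 6"
  define F2 where "F2 v = lax a (1::nat) 2 (v $ 1)" for v :: "complex2 ^ 6"
  have "v $ 4 = w $ 4 \<and> v $ 5 = w $ 5 \<and> v $ 6 = w $ 6 \<and> F3 v = F3 w"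
  proof (rule lax_peel)
    show "inj (F3 v)"
      unfolding F3_def using par nz by (intro bij_is_inj bij_comp bij_lax) auto
    show "F3 v (lax d 1 4 (v $ 4) (lax e 2 4 (v $ 5) (lax f 3 4 (v $ 6) \<xi>))) =
      F3 w (lax d 1 4 (w $ 4) (lax e 2 4 (w $ 5) (lax f 3 4 (w $ 6) \<xi>)))" for \<xi>
      using fun_cong[OF eq, of \<xi>] by (simp add: word_def F3_def)
  qed (use par nz in \<open>simp_all add: F3_def lax_other lax_unit_vector\<close>)
  moreover from this have "v $ 2 = w $ 2 \<and> v $ 3 = w $ 3 \<and> u = u \<and> F2 v = F2 w"
  proof (intro lax_peel)
    assume *: "v $ 4 = w $ 4 \<and> v $ 5 = w $ 5 \<and> v $ 6 = w $ 6 \<and> F3 v = F3 w"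
    show "inj (F2 v)"
      unfolding F2_def using par nz by (intro bij_is_inj bij_lax) auto
    show "F2 v (lax b 1 3 (v $ 2) (lax c 2 3 (v $ 3) (lax 1 4 3 u \<xi>))) =
      F2 w (lax b 1 3 (w $ 2) (lax c 2 3 (w $ 3) (lax 1 4 3 u \<xi>)))" for \<xi>
      using * by (simp add: fun_eq_iff F2_def F3_def)
  qed (use par nz u in \<open>simp_all add: F2_def lax_other lax_unit_vector\<close>)
  moreover from this have "v $ 1 = w $ 1 \<and> u = u \<and> u = u \<and> (id :: (nat \<Rightarrow> complex) \<Rightarrow> _) = id"
  proof (intro lax_peel)
    assume *: "v $ 2 = w $ 2 \<and> v $ 3 = w $ 3 \<and> u = u \<and> F2 v = F2 w"
    show "id (lax a (1::nat) 2 (v $ 1) (lax 1 3 2 u (lax 1 4 2 u \<xi>))) =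
      id (lax a 1 2 (w $ 1) (lax 1 3 2 u (lax 1 4 2 u \<xi>)))" for \<xi>
      using * by (simp add: fun_eq_iff F2_def)
  qed (use par nz u in simp_all)
  ultimately have "v $ m = w $ m" for m
    using exhaust_6[of m] by auto
  then show ?thesis
    by (simp add: vec_eq_iff)
qed

text \<open>Both sides change only the coordinates \<open>i\<close>, \<open>j\<close>,
  \<open>k\<close>, which become linear forms in \<open>\<xi> i\<close>, \<open>\<xi> j\<close>,
  \<open>\<xi> k\<close>; their coefficients match by \<open>T6_relations\<close> and
  \<open>U * V = X * Y\<close>. Since the indices are arbitrary, the identity serves all four
  faces.\<close>

lemma T6_lax:
  assumes T: "T6 a b c (r, s, t) = Some (r', s', t')"
    and nz: "nonzero r'" "nonzero s'" "nonzero t'" and dist: "distinct [i, j, k]"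
  shows "lax a i j r' (lax b i k s' (lax c j k t' \<xi>)) = lax c j k t (lax b i k s (lax a i j r \<xi>))"
proof -
  obtain x1 X y1 Y z1 Z where r: "r = (x1, X)" "s = (y1, Y)" "t = (z1, Z)"
    by (metis surj_pair)
  obtain u1 U v1 V w1 W where r': "r' = (u1, U)" "s' = (v1, V)" "t' = (w1, W)"
    by (metis surj_pair)
  define q1 q2 q3 r1 r2 r3 where "q1 = x1 * X" and "q2 = y1 * Y" and "q3 = z1 * Z"
    and "r1 = u1 * U" and "r2 = v1 * V" and "r3 = w1 * W"
  note q_defs = this
  define p1 p2 p3 s1 s2 s3 where "p1 = (X - a) / q1" and "p2 = (Y - b) / q2" and "p3 = (Z - c) / q3"
    and "s1 = (U - a) / r1" and "s2 = (V - b) / r2" and "s3 = (W - c) / r3"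
  note p_defs = this
  have ne: "i \<noteq> j" "i \<noteq> k" "j \<noteq> k"
    using dist by auto
  have nz': "u1 \<noteq> 0" "v1 \<noteq> 0" "w1 \<noteq> 0"
    using nz by (simp_all add: nonzero_def r')
  note rel = T6_relations[OF T[unfolded r r'] nz', folded q_defs, folded p_defs]
  have UV: "U * V = X * Y"
    using T6_products[OF T[unfolded r r']] by simp
  have "U * (V * \<xi> i + r2 * (s3 * \<xi> j + \<xi> k)) + r1 * (W * \<xi> j + r3 * \<xi> k)
      = U * V * \<xi> i + (U * r2 * s3 + r1 * W) * \<xi> j + (U * r2 + r1 * r3) * \<xi> k"
    by algebra
  also have "\<dots> = Y * (X * \<xi> i + q1 * \<xi> j) + q2 * \<xi> k"
    unfolding UV rel(3,4) by algebra
  finally have i: "U * (V * \<xi> i + r2 * (s3 * \<xi> j + \<xi> k)) + r1 * (W * \<xi> j + r3 * \<xi> k)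
      = Y * (X * \<xi> i + q1 * \<xi> j) + q2 * \<xi> k" .
  have "s1 * (V * \<xi> i + r2 * (s3 * \<xi> j + \<xi> k)) + (W * \<xi> j + r3 * \<xi> k)
      = s1 * V * \<xi> i + (s1 * r2 * s3 + W) * \<xi> j + (s1 * r2 + r3) * \<xi> k"
    by algebra
  also have "\<dots> = Z * (p1 * \<xi> i + \<xi> j) + q3 * (p2 * (X * \<xi> i + q1 * \<xi> j) + \<xi> k)"
    unfolding rel(5-7) by algebra
  finally have j: "s1 * (V * \<xi> i + r2 * (s3 * \<xi> j + \<xi> k)) + (W * \<xi> j + r3 * \<xi> k)
      = Z * (p1 * \<xi> i + \<xi> j) + q3 * (p2 * (X * \<xi> i + q1 * \<xi> j) + \<xi> k)" .
  have k: "s2 * \<xi> i + (s3 * \<xi> j + \<xi> k) = p3 * (p1 * \<xi> i + \<xi> j) + (p2 * (X * \<xi> i + q1 * \<xi> j) + \<xi> k)"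
    unfolding rel(1,2) by algebra
  show ?thesis
    unfolding r r' lax_def prod.case q_defs[symmetric] p_defs[symmetric]
    using ne i j k by (auto simp: fun_eq_iff)
qed

text \<open>Nonvanishing propagates backwards: the three factors acted on are nonzero because
  \<open>T6\<close> is defined there, the others because they are unchanged. A condition on the
  final image thus suffices for a whole composite.\<close>

lemma act_on_T6_lax:
  assumes act: "act_on i j k (T6 a b c) v = Some w" and nz: "\<And>m. nonzero (w $ m)"
    and dist: "distinct [i, j, k]"
  shows "\<And>m. nonzero (v $ m)" and "\<And>m. m \<noteq> i \<Longrightarrow> m \<noteq> j \<Longrightarrow> m \<noteq> k \<Longrightarrow> w $ m = v $ m"
    and "\<And>l m n \<xi>. distinct [l, m, n] \<Longrightarrow>
      lax a l m (w $ i) (lax b l n (w $ j) (lax c m n (w $ k) \<xi>)) =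
      lax c m n (v $ k) (lax b l n (v $ j) (lax a l m (v $ i) \<xi>))"
proof -
  obtain p q r where T: "T6 a b c (v $ i, v $ j, v $ k) = Some (p, q, r)"
    and w: "w = (\<chi> l. if l = i then p else if l = j then q else if l = k then r else v $ l)"
    using act by (auto simp: act_on_def)
  have pqr: "w $ i = p" "w $ j = q" "w $ k = r"
    using dist by (auto simp: w)
  show other: "w $ m = v $ m" if "m \<noteq> i" "m \<noteq> j" "m \<noteq> k" for m
    using that by (simp add: w)
  obtain x1 X y1 Y z1 Z where v: "v $ i = (x1, X)" "v $ j = (y1, Y)" "v $ k = (z1, Z)"
    by (metis surj_pair)
  have "nonzero (v $ i)" "nonzero (v $ j)" "nonzero (v $ k)"
    using T6_products[of a b c x1 X y1 Y z1 Z] T unfolding v nonzero_def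
    by (metis fst_conv snd_conv surj_pair)+
  then show "nonzero (v $ m)" for m
    using nz[of m] other[of m] by metis
  show "lax a l m (w $ i) (lax b l n (w $ j) (lax c m n (w $ k) \<xi>)) =
      lax c m n (v $ k) (lax b l n (v $ j) (lax a l m (v $ i) \<xi>))"
    if "distinct [l, m, n]" for l m n :: 'c and \<xi>
    unfolding pqr using T nz[of i] nz[of j] nz[of k] that unfolding pqr by (intro T6_lax)
qed

section \<open>Transport of words along the two composites\<close>

definition reversed_word :: "complex \<Rightarrow> complex \<Rightarrow> complex \<Rightarrow> complex \<Rightarrow> complex \<Rightarrow> complex \<Rightarrow>
    complex2 ^ 6 \<Rightarrow> (nat \<Rightarrow> complex) \<Rightarrow> (nat \<Rightarrow> complex)" where
  "reversed_word a b c d e f v \<xi> = lax f 3 4 (v $ 6) (lax e 2 4 (v $ 5) (lax d 1 4 (v $ 4)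
     (lax c 2 3 (v $ 3) (lax b 1 3 (v $ 2) (lax a 1 2 (v $ 1) \<xi>)))))"

text \<open>The composite is followed from its image back to \<open>v\<close>. Undoing its maps
  reverses the edge triples of the faces 123, 124, 134, 234 in turn; between these moves, edges
  without a common vertex are exchanged.\<close>

lemma word_left_side:
  assumes 1: "act_on 3 5 6 (T6 c e f) v = Some v1" and 2: "act_on 2 4 6 (T6 b d f) v1 = Some v2"
    and 3: "act_on 1 4 5 (T6 a d e) v2 = Some v3" and 4: "act_on 1 2 3 (T6 a b c) v3 = Some v4"
    and nz: "\<And>m. nonzero (v4 $ m)"
  shows "word a b c d e f v4 = reversed_word a b c d e f v"
proof
  fix \<xi> :: "nat \<Rightarrow> complex"
  note s4 = act_on_T6_lax[OF 4 nz]
  note s3 = act_on_T6_lax[OF 3 s4(1)]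
  note s2 = act_on_T6_lax[OF 2 s3(1)]
  note s1 = act_on_T6_lax[OF 1 s2(1)]
  have "word a b c d e f v4 \<xi> = lax c 2 3 (v3 $ 3) (lax b 1 3 (v3 $ 2) (lax a 1 2 (v3 $ 1)
     (lax d 1 4 (v3 $ 4) (lax e 2 4 (v3 $ 5) (lax f 3 4 (v3 $ 6) \<xi>)))))"
    using s4(2)[of 4] s4(2)[of 5] s4(2)[of 6] by (simp add: word_def s4(3))
  also have "\<dots> = lax c 2 3 (v2 $ 3) (lax b 1 3 (v2 $ 2) (lax e 2 4 (v2 $ 5)
     (lax d 1 4 (v2 $ 4) (lax a 1 2 (v2 $ 1) (lax f 3 4 (v2 $ 6) \<xi>)))))"
    using s3(2)[of 2] s3(2)[of 3] s3(2)[of 6] by (simp add: s3(3))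
  also have "\<dots> = lax c 2 3 (v2 $ 3) (lax e 2 4 (v2 $ 5) (lax b 1 3 (v2 $ 2)
     (lax d 1 4 (v2 $ 4) (lax f 3 4 (v2 $ 6) (lax a 1 2 (v2 $ 1) \<xi>)))))"
    \<comment> \<open>Exchanging 13 with 24 and 12 with 34 makes the edges 13, 14, 34 of the next
      face adjacent.\<close>
    by (simp del: One_nat_def add: lax_commute[of 1 3 2 4 b] lax_commute[of 1 2 3 4 a])
  also have "\<dots> = lax c 2 3 (v1 $ 3) (lax e 2 4 (v1 $ 5) (lax f 3 4 (v1 $ 6)
     (lax d 1 4 (v1 $ 4) (lax b 1 3 (v1 $ 2) (lax a 1 2 (v1 $ 1) \<xi>)))))"
    using s2(2)[of 1] s2(2)[of 3] s2(2)[of 5] by (simp add: s2(3))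
  also have "\<dots> = lax f 3 4 (v $ 6) (lax e 2 4 (v $ 5) (lax c 2 3 (v $ 3)
     (lax d 1 4 (v $ 4) (lax b 1 3 (v $ 2) (lax a 1 2 (v $ 1) \<xi>)))))"
    using s1(2)[of 1] s1(2)[of 2] s1(2)[of 4] by (simp add: s1(3))
  also have "\<dots> = reversed_word a b c d e f v \<xi>"
    by (simp del: One_nat_def add: reversed_word_def lax_commute[of 2 3 1 4])
  finally show "word a b c d e f v4 \<xi> = reversed_word a b c d e f v \<xi>" .
qed

text \<open>The same transport with the faces met in the opposite order 234, 134, 124, 123, so the
  exchange of 23 with 14 now comes first.\<close>

lemma word_right_side:
  assumes 1: "act_on 1 2 3 (T6 a b c) v = Some v1" and 2: "act_on 1 4 5 (T6 a d e) v1 = Some v2"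
    and 3: "act_on 2 4 6 (T6 b d f) v2 = Some v3" and 4: "act_on 3 5 6 (T6 c e f) v3 = Some v4"
    and nz: "\<And>m. nonzero (v4 $ m)"
  shows "word a b c d e f v4 = reversed_word a b c d e f v"
proof
  fix \<xi> :: "nat \<Rightarrow> complex"
  note s4 = act_on_T6_lax[OF 4 nz]
  note s3 = act_on_T6_lax[OF 3 s4(1)]
  note s2 = act_on_T6_lax[OF 2 s3(1)]
  note s1 = act_on_T6_lax[OF 1 s2(1)]
  have "word a b c d e f v4 \<xi> = lax a 1 2 (v4 $ 1) (lax b 1 3 (v4 $ 2) (lax d 1 4 (v4 $ 4)
     (lax c 2 3 (v4 $ 3) (lax e 2 4 (v4 $ 5) (lax f 3 4 (v4 $ 6) \<xi>)))))"
    by (simp del: One_nat_def add: word_def lax_commute[of 2 3 1 4])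
  also have "\<dots> = lax a 1 2 (v3 $ 1) (lax b 1 3 (v3 $ 2) (lax d 1 4 (v3 $ 4)
     (lax f 3 4 (v3 $ 6) (lax e 2 4 (v3 $ 5) (lax c 2 3 (v3 $ 3) \<xi>)))))"
    using s4(2)[of 1] s4(2)[of 2] s4(2)[of 4] by (simp add: s4(3))
  also have "\<dots> = lax a 1 2 (v2 $ 1) (lax f 3 4 (v2 $ 6) (lax d 1 4 (v2 $ 4)
     (lax b 1 3 (v2 $ 2) (lax e 2 4 (v2 $ 5) (lax c 2 3 (v2 $ 3) \<xi>)))))"
    using s3(2)[of 1] s3(2)[of 3] s3(2)[of 5] by (simp add: s3(3))
  also have "\<dots> = lax f 3 4 (v2 $ 6) (lax a 1 2 (v2 $ 1) (lax d 1 4 (v2 $ 4)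
     (lax e 2 4 (v2 $ 5) (lax b 1 3 (v2 $ 2) (lax c 2 3 (v2 $ 3) \<xi>)))))"
    by (simp del: One_nat_def add: lax_commute[of 1 2 3 4 a] lax_commute[of 1 3 2 4 b])
  also have "\<dots> = lax f 3 4 (v1 $ 6) (lax e 2 4 (v1 $ 5) (lax d 1 4 (v1 $ 4)
     (lax a 1 2 (v1 $ 1) (lax b 1 3 (v1 $ 2) (lax c 2 3 (v1 $ 3) \<xi>)))))"
    using s2(2)[of 2] s2(2)[of 3] s2(2)[of 6] by (simp add: s2(3))
  also have "\<dots> = reversed_word a b c d e f v \<xi>"
    using s1(2)[of 4] s1(2)[of 5] s1(2)[of 6] by (simp add: reversed_word_def s1(3))
  finally show "word a b c d e f v4 \<xi> = reversed_word a b c d e f v \<xi>" .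
qed

section \<open>The tetrahedron equation\<close>

text \<open>
  Composing with \<open>guard\<close> excludes, while keeping the domain a hypersurface complement, the image
  points at which a Lax matrix would have a zero denominator.
\<close>

definition guard :: "complex2 ^ 6 \<rightharpoonup> complex2 ^ 6" where
  "guard v = (if (\<Prod>m\<in>UNIV. fst (v $ m) * snd (v $ m)) = 0 then None else Some v)"

lemma guard_eq_Some: "guard v = Some w \<longleftrightarrow> w = v \<and> (\<forall>m. nonzero (v $ m))"
  by (auto simp: guard_def nonzero_def)

lemma regular_map_guard: "regular_map guard"
proof (rule regular_map_Some[where g = "\<lambda>v. v"])
  have "(\<lambda>v :: complex2 ^ 6. fst (v $ m)) \<in> polynomials" "(\<lambda>v :: complex2 ^ 6. snd (v $ m)) \<in> polynomials" for m
    by (auto intro!: polynomials.coord coords_vec_nth[of fst] coords_vec_nth[of snd]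
        coords_fst[of "\<lambda>v. v"] coords_snd[of "\<lambda>v. v"] simp: coords_complex)
  then show "(\<lambda>v :: complex2 ^ 6. \<Prod>m\<in>UNIV. fst (v $ m) * snd (v $ m)) \<in> polynomials"
    by (intro polynomials_intros)
qed (auto simp: guard_def intro: regular_on_polynomial polynomials.coord)

text \<open>Along upper triangular points the second components \<open>s\<close> stay fixed, so
  composites can be computed on the first components \<open>t\<close> alone.\<close>

lemma act_on_upper_triangular:
  fixes s :: "'n::finite \<Rightarrow> complex"
  assumes "distinct [i, j, k]" and "s i \<noteq> 0" "s j \<noteq> 0" "s k \<noteq> 0" "t i \<noteq> 0" "t j \<noteq> 0" "t k \<noteq> 0"
    and t': "t' = t(i := s j * t i / s k, j := (t j - s i * t i * t k) / s i)"
  shows "act_on i j k (T6 (s i) (s j) (s k)) (\<chi> m. (t m, s m)) = Some (\<chi> m. (t' m, s m))"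
  using assms by (auto simp: act_on_def T6_upper_triangular vec_eq_iff)

lemma tetrahedron_witness:
  assumes "a \<noteq> 0" "b \<noteq> 0" "c \<noteq> 0" "d \<noteq> 0" "e \<noteq> 0" "f \<noteq> 0"
  obtains v w w' where
    "(act_on (1::6) 2 3 (T6 a b c) \<circ>\<^sub>m act_on 1 4 5 (T6 a d e) \<circ>\<^sub>m
      act_on 2 4 6 (T6 b d f) \<circ>\<^sub>m act_on 3 5 6 (T6 c e f)) v = Some w" "\<And>m. nonzero (w $ m)"
    "(act_on (3::6) 5 6 (T6 c e f) \<circ>\<^sub>m act_on 2 4 6 (T6 b d f) \<circ>\<^sub>m
      act_on 1 4 5 (T6 a d e) \<circ>\<^sub>m act_on 1 2 3 (T6 a b c)) v = Some w'" "\<And>m. nonzero (w' $ m)"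
proof -
  define s :: "6 \<Rightarrow> complex" where
    "s = (\<lambda>m. if m = 1 then a else if m = 2 then b else if m = 3 then c else if m = 4 then d
      else if m = 5 then e else f)"
  have s: "s 1 = a" "s 2 = b" "s 3 = c" "s 4 = d" "s 5 = e" "s 6 = f"
    by (simp_all add: s_def)
  have s0: "s m \<noteq> 0" for m
    using exhaust_6[of m] s assms by auto
  \<comment> \<open>Chosen so that each map turns its middle coordinate \<open>t j\<close> into
    \<open>t j / (2 * s i)\<close>, and the subtraction never produces zero. Indices 2 and 5 are in
    the middle position once and index 4 twice, whence the factors 2, 2 and 4.\<close>
  define t :: "6 \<Rightarrow> complex" where
    "t = (\<lambda>m. if m = 2 then 2 * a else if m = 4 then 4 * a * b else if m = 5 then 2 * c else 1)"
  have t: "t 1 = 1" "t 2 = 2 * a" "t 3 = 1" "t 4 = 4 * a * b" "t 5 = 2 * c" "t 6 = 1"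
    by (simp_all add: t_def)
  define t1 where "t1 = t(3 := e / f, 5 := 1)"
  define t2 where "t2 = t1(2 := d * (2 * a) / f, 4 := 2 * a)"
  define t3 where "t3 = t2(1 := d / e, 4 := 1)"
  define t4 where "t4 = t3(1 := b / c * (d / e), 2 := d / f)"
  have l1: "act_on 3 5 6 (T6 c e f) (\<chi> m. (t m, s m)) = Some (\<chi> m. (t1 m, s m))"
    using act_on_upper_triangular[of 3 5 6 s t t1] assms by (simp add: s t t1_def)
  have l2: "act_on 2 4 6 (T6 b d f) (\<chi> m. (t1 m, s m)) = Some (\<chi> m. (t2 m, s m))"
    using act_on_upper_triangular[of 2 4 6 s t1 t2] assms by (simp add: s t t1_def t2_def)
  have l3: "act_on 1 4 5 (T6 a d e) (\<chi> m. (t2 m, s m)) = Some (\<chi> m. (t3 m, s m))"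
    using act_on_upper_triangular[of 1 4 5 s t2 t3] assms by (simp add: s t t1_def t2_def t3_def)
  have l4: "act_on 1 2 3 (T6 a b c) (\<chi> m. (t3 m, s m)) = Some (\<chi> m. (t4 m, s m))"
    using act_on_upper_triangular[of 1 2 3 s t3 t4] assms
    by (simp add: s t t1_def t2_def t3_def t4_def field_simps)
  have t4: "t4 m \<noteq> 0" for m
    using assms by (simp add: t4_def t3_def t2_def t1_def t_def)
  define r1 where "r1 = t(1 := b / c, 2 := 1)"
  define r2 where "r2 = r1(1 := d / e * (b / c), 4 := 2 * b)"
  define r3 where "r3 = r2(2 := d / f, 4 := 1)"
  define r4 where "r4 = r3(3 := e / f, 5 := 1)"
  have r1: "act_on 1 2 3 (T6 a b c) (\<chi> m. (t m, s m)) = Some (\<chi> m. (r1 m, s m))"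
    using act_on_upper_triangular[of 1 2 3 s t r1] assms by (simp add: s t r1_def)
  have r2: "act_on 1 4 5 (T6 a d e) (\<chi> m. (r1 m, s m)) = Some (\<chi> m. (r2 m, s m))"
    using act_on_upper_triangular[of 1 4 5 s r1 r2] assms
    by (simp add: s t r1_def r2_def field_simps)
  have r3: "act_on 2 4 6 (T6 b d f) (\<chi> m. (r2 m, s m)) = Some (\<chi> m. (r3 m, s m))"
    using act_on_upper_triangular[of 2 4 6 s r2 r3] assms by (simp add: s t r1_def r2_def r3_def)
  have r4: "act_on 3 5 6 (T6 c e f) (\<chi> m. (r3 m, s m)) = Some (\<chi> m. (r4 m, s m))"
    using act_on_upper_triangular[of 3 5 6 s r3 r4] assms
    by (simp add: s t r1_def r2_def r3_def r4_def)
  have r4': "r4 m \<noteq> 0" for m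
    using assms by (simp add: r4_def r3_def r2_def r1_def t_def)
  show ?thesis
  proof (rule that)
    show "(act_on 1 2 3 (T6 a b c) \<circ>\<^sub>m act_on 1 4 5 (T6 a d e) \<circ>\<^sub>m
      act_on 2 4 6 (T6 b d f) \<circ>\<^sub>m act_on 3 5 6 (T6 c e f)) (\<chi> m. (t m, s m)) = Some (\<chi> m. (t4 m, s m))"
      by (simp add: l1 l2 l3 l4)
    show "(act_on 3 5 6 (T6 c e f) \<circ>\<^sub>m act_on 2 4 6 (T6 b d f) \<circ>\<^sub>m
      act_on 1 4 5 (T6 a d e) \<circ>\<^sub>m act_on 1 2 3 (T6 a b c)) (\<chi> m. (t m, s m)) = Some (\<chi> m. (r4 m, s m))"
      by (simp add: r1 r2 r3 r4)
  qed (simp_all add: nonzero_def s0 t4 r4')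
qed

text \<open>Where both guarded composites are defined, the words of their values both equal the
  reversed word of the starting point, so \<open>word_inj\<close> identifies the values. The witness
  shows that this happens at some point, hence generically.\<close>

lemma tetrahedron_T6: "parametric_tetrahedron_map (- {0}) T6"
  unfolding parametric_tetrahedron_map_def
proof (intro conjI ballI)
  fix a b c :: complex assume "a \<in> - {0}" "b \<in> - {0}" "c \<in> - {0}"
  then show "rational_map (T6 a b c)"
    by (intro rational_mapI[OF regular_map_T6, of _ _ _ "((1, a), (1, b), (1, c))"])
      (simp add: T6_upper_triangular)
next
  fix a b c d e f :: complex
  assume "a \<in> - {0}" "b \<in> - {0}" "c \<in> - {0}" "d \<in> - {0}" "e \<in> - {0}" "f \<in> - {0}"
  then have par: "a \<noteq> 0" "b \<noteq> 0" "c \<noteq> 0" "d \<noteq> 0" "e \<noteq> 0" "f \<noteq> 0"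
    by auto
  define L where "L = act_on (1::6) 2 3 (T6 a b c) \<circ>\<^sub>m act_on 1 4 5 (T6 a d e) \<circ>\<^sub>m
    act_on 2 4 6 (T6 b d f) \<circ>\<^sub>m act_on 3 5 6 (T6 c e f)"
  define R where "R = act_on (3::6) 5 6 (T6 c e f) \<circ>\<^sub>m act_on 2 4 6 (T6 b d f) \<circ>\<^sub>m
    act_on 1 4 5 (T6 a d e) \<circ>\<^sub>m act_on 1 2 3 (T6 a b c)"
  obtain u w w' where u: "L u = Some w" "\<And>m. nonzero (w $ m)" "R u = Some w'" "\<And>m. nonzero (w' $ m)"
    using tetrahedron_witness[OF par] unfolding L_def R_def by metis
  have "rat_eq L R"
  proof (rule rat_eqI[of "guard \<circ>\<^sub>m L" "guard \<circ>\<^sub>m R"])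
    show "regular_map (guard \<circ>\<^sub>m L)" "regular_map (guard \<circ>\<^sub>m R)"
      unfolding L_def R_def
      by (intro regular_map_comp regular_map_guard regular_map_act_on regular_map_T6)+
    have "guard w = Some w" "guard w' = Some w'"
      using u by (simp_all add: guard_eq_Some)
    then show "(guard \<circ>\<^sub>m L) u \<noteq> None" "(guard \<circ>\<^sub>m R) u \<noteq> None"
      using u by simp_all
  next
    fix v assume "(guard \<circ>\<^sub>m L) v \<noteq> None" "(guard \<circ>\<^sub>m R) v \<noteq> None"
    then obtain x y where x: "L v = Some x" "\<And>m. nonzero (x $ m)"
      and y: "R v = Some y" "\<And>m. nonzero (y $ m)"
      by (force simp: map_comp_def guard_eq_Some split: option.splits)
    have "word a b c d e f x = reversed_word a b c d e f v"
      using x unfolding L_def by (auto simp: map_comp_Some_iff intro: word_left_side)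
    moreover have "word a b c d e f y = reversed_word a b c d e f v"
      using y unfolding R_def by (auto simp: map_comp_Some_iff intro: word_right_side)
    ultimately have "x = y"
      using word_inj[OF par x(2) y(2)] by simp
    then show "\<exists>w. L v = Some w \<and> R v = Some w"
      using x y by simp
  qed
  then show "rat_eq (act_on (1::6) 2 3 (T6 a b c) \<circ>\<^sub>m act_on 1 4 5 (T6 a d e) \<circ>\<^sub>m
      act_on 2 4 6 (T6 b d f) \<circ>\<^sub>m act_on 3 5 6 (T6 c e f))
    (act_on 3 5 6 (T6 c e f) \<circ>\<^sub>m act_on 2 4 6 (T6 b d f) \<circ>\<^sub>m
      act_on 1 4 5 (T6 a d e) \<circ>\<^sub>m act_on 1 2 3 (T6 a b c))"
    unfolding L_def R_def .
qed

section \<open>Invariants\<close>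

lemma regular_map_I1: "regular_map I1"
proof (rule regular_map_Some)
  show "(\<lambda>v. snd (snd (snd v))) \<in> polynomials"
    by (rule polynomials_coordinates)
  show "I1 v = (if snd (snd (snd v)) = 0 then None else Some (snd (fst v) / snd (snd (snd v))))" for v
    by (simp add: I1_def case_prod_beta)
  have "(\<lambda>v :: complex2 \<times> complex2 \<times> complex2. snd (fst v) / snd (snd (snd v)))
      \<in> regular_on (\<lambda>v. snd (snd (snd v)))"
    by (rule regular_on_divide[where k = 1 and h = "\<lambda>_. 1"])
      (auto intro: polynomials_coordinates polynomials.const)
  then show "(\<lambda>v :: complex2 \<times> complex2 \<times> complex2. \<phi> (snd (fst v) / snd (snd (snd v))))
      \<in> regular_on (\<lambda>v. snd (snd (snd v)))" if "\<phi> \<in> coords" for \<phi>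
    using that by (simp add: coords_complex)
qed

lemma regular_map_I2: "regular_map I2"
proof -
  have "(\<lambda>v :: complex2 \<times> complex2 \<times> complex2. snd (fst v) * snd (fst (snd v))) \<in> polynomials"
    by (intro polynomials_intros polynomials_coordinates)
  from regular_map_total[OF this] show ?thesis
    by (simp add: I2_def case_prod_beta')
qed

lemma regular_map_I3: "regular_map (I3 a b c)"
proof -
  define x y z X Y Z :: "complex2 \<times> complex2 \<times> complex2 \<Rightarrow> complex" where
    "x = (\<lambda>v. fst (fst v))" and "y = (\<lambda>v. fst (fst (snd v)))" and "z = (\<lambda>v. fst (snd (snd v)))"
    and "X = (\<lambda>v. snd (fst v))" and "Y = (\<lambda>v. snd (fst (snd v)))" and "Z = (\<lambda>v. snd (snd (snd v)))"
  define d where "d v = x v * z v * X v * Z v * (y v * Y v)" for v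
  define p where "p v = Z v - b * X v - a * Y v * Z v" for v
  define q where "q v = y v * Y v * (a - X v) * (c - Z v)" for v
  define r where "r v = - (x v * z v * X v * Z v * (b - Y v))" for v
  have proj: "x \<in> polynomials" "y \<in> polynomials" "z \<in> polynomials"
    "X \<in> polynomials" "Y \<in> polynomials" "Z \<in> polynomials"
    unfolding x_def y_def z_def X_def Y_def Z_def by (rule polynomials_coordinates)+
  have d: "d \<in> polynomials"
    unfolding d_def by (intro polynomials_intros proj)
  have pq: "p \<in> polynomials" "q \<in> polynomials"
    unfolding p_def q_def by (intro polynomials_intros proj)+
  have r: "r \<in> polynomials"
    using polynomials_minus[OF polynomials.const[of 0], of "\<lambda>v. x v * z v * X v * Z v * (b - Y v)"]
    unfolding r_def by (simp add: polynomials_intros proj)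
  have "(\<lambda>v. q v / (x v * z v * X v * Z v)) \<in> regular_on d"
    by (rule regular_on_divide[where k = 1 and h = "\<lambda>v. y v * Y v"])
      (auto intro!: polynomials_intros proj pq simp: d_def)
  moreover have "(\<lambda>v. r v / (y v * Y v)) \<in> regular_on d"
    by (rule regular_on_divide[where k = 1 and h = "\<lambda>v. x v * z v * X v * Z v"])
      (auto intro!: polynomials_intros proj r simp: d_def)
  ultimately have g: "(\<lambda>v. p v + q v / (x v * z v * X v * Z v) + r v / (y v * Y v)) \<in> regular_on d"
    by (intro regular_on_add d regular_on_polynomial[OF pq(1)])
  show ?thesis
  proof (rule regular_map_Some[OF d])
    show "I3 a b c v = (if d v = 0 then None
        else Some (p v + q v / (x v * z v * X v * Z v) + r v / (y v * Y v)))" for v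
      by (simp add: case_prod_beta I3_def d_def p_def q_def r_def x_def y_def z_def X_def Y_def Z_def)
    show "(\<lambda>v. \<phi> (p v + q v / (x v * z v * X v * Z v) + r v / (y v * Y v))) \<in> regular_on d"
      if "\<phi> \<in> coords" for \<phi>
      using that g by (simp add: coords_complex)
  qed
qed

lemma T6_invariant_I3:
  assumes T: "T6 a b c v = Some w" and v: "I3 a b c v = Some g" and w: "I3 a b c w = Some h"
  shows "h = g"
proof -
  obtain x1 X y1 Y z1 Z where v': "v = ((x1, X), (y1, Y), (z1, Z))"
    by (metis surj_pair)
  obtain u1 U v1 V w1 W where w': "w = ((u1, U), (v1, V), (w1, W))"
    by (metis surj_pair)
  define q1 q2 q3 r1 r2 r3 where "q1 = x1 * X" and "q2 = y1 * Y" and "q3 = z1 * Z"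
    and "r1 = u1 * U" and "r2 = v1 * V" and "r3 = w1 * W"
  note q_defs = this
  define p1 p2 p3 s1 s2 s3 where "p1 = (X - a) / q1" and "p2 = (Y - b) / q2" and "p3 = (Z - c) / q3"
    and "s1 = (U - a) / r1" and "s2 = (V - b) / r2" and "s3 = (W - c) / r3"
  note p_defs = this
  \<comment> \<open>Definedness of \<open>I3\<close> at the image provides the nonvanishing that
    \<open>T6_relations\<close> asks for.\<close>
  have nz: "u1 \<noteq> 0" "v1 \<noteq> 0" "w1 \<noteq> 0" "x1 \<noteq> 0" "y1 \<noteq> 0" "z1 \<noteq> 0"
    using v w by (auto simp: I3_def v' w' split: if_splits)
  note prod = T6_products[OF T[unfolded v' w']]
  note rel = T6_relations[OF T[unfolded v' w'] nz(1-3), folded q_defs, folded p_defs]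
  have g: "g = Z - b * X - a * Y * Z + q2 * p1 * p3 + q1 * q3 * p2"
    using v nz prod by (auto simp: I3_def v' q_defs p_defs field_simps split: if_splits)
  have h: "h = W - b * U - a * V * W + r2 * s1 * s3 + r1 * r3 * s2"
    using w nz prod by (auto simp: I3_def w' q_defs p_defs field_simps split: if_splits)
  have V: "r2 * s2 = V - b" and Y: "q2 * p2 = Y - b"
    using nz prod by (simp_all add: q_defs p_defs)
  have "r2 * s1 * s3 = Z + q3 * p2 * q1 - W"
    using rel(6) by (simp add: algebra_simps)
  moreover have "r1 * r3 * s2 = q2 * s2 - U * (r2 * s2)"
    unfolding rel(4)[symmetric] by algebra
  moreover have "q2 * s2 = q2 * p1 * p3 + q2 * p2 * X"
    unfolding rel(1) by algebra
  ultimately have "h = W - b * U - a * (V * W) + (Z + q3 * p2 * q1 - W)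
      + (q2 * p1 * p3 + (Y - b) * X - U * (V - b))"
    unfolding h V Y by simp
  also have "\<dots> = - a * (V * W) + (Z + q3 * p2 * q1) + q2 * p1 * p3 + (Y - b) * X - U * V"
    by algebra
  also have "\<dots> = g"
    unfolding prod(1,2) g by algebra
  finally show ?thesis .
qed

lemma T6_invariants:
  assumes abc: "a \<noteq> 0" "b \<noteq> 0" "c \<noteq> 0"
  shows "is_invariant (T6 a b c) I1" "is_invariant (T6 a b c) I2" "is_invariant (T6 a b c) (I3 a b c)"
proof -
  \<comment> \<open>The value \<open>2 * a\<close> makes the middle image coordinate
    \<open>(2 * a - a) / a = 1\<close>, so \<open>I3\<close> is defined at the image as
    well.\<close>
  define v :: "complex2 \<times> complex2 \<times> complex2" where "v = ((1, a), (2 * a, b), (1, c))"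
  have T: "T6 a b c v = Some ((b / c, a), (1, b), (1, c))"
    using abc T6_upper_triangular[of a b c 1 "2 * a" 1] by (simp add: v_def)
  show "is_invariant (T6 a b c) I1"
  proof (rule invariantI[where v = v, OF regular_map_T6 regular_map_I1])
    fix v w x y assume "T6 a b c v = Some w" "I1 v = Some x" "I1 w = Some y"
    moreover obtain x1 X y1 Y z1 Z where "v = ((x1, X), (y1, Y), (z1, Z))"
      by (metis surj_pair)
    moreover obtain u1 U v1 V w1 W where "w = ((u1, U), (v1, V), (w1, W))"
      by (metis surj_pair)
    ultimately have "U * V = X * Y" "V * W = Y * Z" "V \<noteq> 0" "W \<noteq> 0" "Y \<noteq> 0" "Z \<noteq> 0"
      and xy: "x = X / Z" "y = U / W"
      using T6_products[of a b c x1 X y1 Y z1 Z u1 U v1 V w1 W] by (auto simp: I1_def split: if_splits)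
    \<comment> \<open>The two product relations \<open>U * V = X * Y\<close> and
      \<open>V * W = Y * Z\<close> divided by each other, in cross-multiplied form.\<close>
    then have "(U * Z) * (V * Y) = (X * W) * (V * Y)"
      by algebra
    then show "y = x"
      using \<open>V \<noteq> 0\<close> \<open>W \<noteq> 0\<close> \<open>Y \<noteq> 0\<close> \<open>Z \<noteq> 0\<close> by (simp add: xy field_simps)
  qed (use abc T in \<open>simp_all add: I1_def v_def\<close>)
  show "is_invariant (T6 a b c) I2"
  proof (rule invariantI[where v = v, OF regular_map_T6 regular_map_I2])
    fix v w x y assume "T6 a b c v = Some w" "I2 v = Some x" "I2 w = Some y"
    moreover obtain x1 X y1 Y z1 Z where "v = ((x1, X), (y1, Y), (z1, Z))"
      by (metis surj_pair)
    moreover obtain u1 U v1 V w1 W where "w = ((u1, U), (v1, V), (w1, W))"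
      by (metis surj_pair)
    ultimately show "y = x"
      using T6_products[of a b c x1 X y1 Y z1 Z u1 U v1 V w1 W] by (auto simp: I2_def)
  qed (use abc T in \<open>simp_all add: I2_def v_def\<close>)
  show "is_invariant (T6 a b c) (I3 a b c)"
    by (rule invariantI[where v = v, OF regular_map_T6 regular_map_I3 _ _ T6_invariant_I3])
      (use abc T in \<open>simp_all add: I3_def v_def\<close>)
qed

text \<open>The point of definedness behind the rationality of \<open>T9\<close> and the generic
  invariance of its three quantities.\<close>

lemma T9_defined: "T9 ((0, 0, 1), (0, 0, 1), (0, 0, 1)) = Some ((0, 0, 1), (0, 0, 1), (0, 0, 1))"
  by (simp add: T9_def Let_def)

theorem theorem5p2:
  shows
    "rational_map T9 \<and>
     is_invariant T9 (\<lambda>((x1, x2, X), (y1, y2, Y), (z1, z2, Z)). Some (X - x1*x2*X^2)) \<and>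
     is_invariant T9 (\<lambda>((x1, x2, X), (y1, y2, Y), (z1, z2, Z)). Some (Y - y1*y2*Y^2)) \<and>
     is_invariant T9 (\<lambda>((x1, x2, X), (y1, y2, Y), (z1, z2, Z)). Some (Z - z1*z2*Z^2)) \<and>
     (\<forall>a b c. a \<noteq> 0 \<and> b \<noteq> 0 \<and> c \<noteq> 0 \<longrightarrow>
        restricts_to T9 (leaf a \<times> leaf b \<times> leaf c) leaf_coords (T6 a b c)) \<and>
     parametric_tetrahedron_map (- {0}) T6 \<and>
     (\<forall>a b c. a \<noteq> 0 \<and> b \<noteq> 0 \<and> c \<noteq> 0 \<longrightarrow>
        is_invariant (T6 a b c) I1 \<and>
        is_invariant (T6 a b c) I2 \<and>
        is_invariant (T6 a b c) (I3 a b c))"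
proof (intro conjI allI impI; (elim conjE)?)
  show "rational_map T9"
    by (rule rational_mapI[where v = "((0, 0, 1), (0, 0, 1), (0, 0, 1))", OF regular_map_T9]) (simp add: T9_defined)
  have reg: "regular_map (\<lambda>((x1, x2, X), (y1, y2, Y), (z1, z2, Z)). Some (X - x1*x2*X^2) :: complex option)"
    "regular_map (\<lambda>((x1, x2, X), (y1, y2, Y), (z1, z2, Z)). Some (Y - y1*y2*Y^2) :: complex option)"
    "regular_map (\<lambda>((x1, x2, X), (y1, y2, Y), (z1, z2, Z)). Some (Z - z1*z2*Z^2) :: complex option)"
    unfolding case_prod_beta'
    by (intro regular_map_total polynomials_intros polynomials_coordinates)+
  note invariantI' = invariantI[where v = "((0, 0, 1), (0, 0, 1), (0, 0, 1))", OF regular_map_T9]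
  show "is_invariant T9 (\<lambda>((x1, x2, X), (y1, y2, Y), (z1, z2, Z)). Some (X - x1*x2*X^2))"
    by (rule invariantI'[OF reg(1)])
      (auto simp: T9_defined dest: T9_invariants(1))
  show "is_invariant T9 (\<lambda>((x1, x2, X), (y1, y2, Y), (z1, z2, Z)). Some (Y - y1*y2*Y^2))"
    by (rule invariantI'[OF reg(2)])
      (auto simp: T9_defined dest: T9_invariants(2))
  show "is_invariant T9 (\<lambda>((x1, x2, X), (y1, y2, Y), (z1, z2, Z)). Some (Z - z1*z2*Z^2))"
    by (rule invariantI'[OF reg(3)])
      (auto simp: T9_defined dest: T9_invariants(3))
  show "parametric_tetrahedron_map (- {0}) T6"
    by (rule tetrahedron_T6)
qed (simp_all add: restricts_to_leaf T6_invariants)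

end
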